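(* Let $k\ge 2$ be a fixed integer, let $r\ge 0$ be a real number, and let $f\in\mathcal{A}_r$. Then for every $\varepsilon>0$, as $x\to\infty$, $$\sum_{n_1,\ldots,n_k\le x} f\left(\frac{[n_1,\ldots,n_k]}{(n_1,\ldots,n_k)}\right)=D_{f,k}\,\frac{x^{k(r+1)}}{(r+1)^k}+O\left(x^{k(r+1)-\frac12+\varepsilon}\right),$$ where $$D_{f,k}=\prod_p\left(1-\frac1p\right)^k\sum_{\nu_1,\ldots,\nu_k=0}^{\infty}\frac{f(p^{\max(\nu_1,\ldots,\nu_k)-\min(\nu_1,\ldots,\nu_k)})}{p^{(r+1)(\nu_1+\cdots+\nu_k)}},$$ the product being over all primes $p$.
   Context: $[n_1,\ldots,n_k]$ and $(n_1,\ldots,n_k)$ denote the least common multiple and the greatest common divisor of the positive integers $n_1,\ldots,n_k$; sums over $n_1,\ldots,n_k\le x$ run over all $k$-tuples of positive integers each at most $x$. Implied constants may depend on $f$, $k$, $r$, $\varepsilon$. For $r\in\mathbb{R}$, $\mathcal{A}_r$ denotes the class of complex valued multiplicative arithmetic functions $f$ for which there exist real constants $C_1,C_2$ such that (i) $|f(p)-p^r|\le C_1p^{r-1/2}$ for every prime $p$, and (ii) $|f(p^\nu)|\le C_2p^{\nu r}$ for every prime power $p^\nu$ with $\nu\ge 2$. *)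

theory Defs
  imports "HOL-Analysis.Analysis" "HOL-Library.Landau_Symbols" "HOL-Computational_Algebra.Primes"
begin

text \<open>
  Arithmetic functions are functions on \<^typ>\<open>nat\<close>; the value at 0 is irrelevant.
\<close>

definition multiplicative_function :: "(nat \<Rightarrow> complex) \<Rightarrow> bool" where
  "multiplicative_function f \<longleftrightarrow>
     f 1 = 1 \<and> (\<forall>m>0. \<forall>n>0. coprime m n \<longrightarrow> f (m * n) = f m * f n)"

definition class_A :: "real \<Rightarrow> (nat \<Rightarrow> complex) set" where
  "class_A r = {f. multiplicative_function f \<and>
     (\<exists>C1 C2 :: real.
        (\<forall>p. prime p \<longrightarrow>
           norm (f p - of_real (real p powr r)) \<le> C1 * real p powr (r - 1/2)) \<and>
        (\<forall>p \<nu>. prime p \<and> \<nu> \<ge> 2 \<longrightarrow>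
           norm (f (p ^ \<nu>)) \<le> C2 * real p powr (real \<nu> * r)))}"

definition lcm_gcd_sum :: "(nat \<Rightarrow> complex) \<Rightarrow> nat \<Rightarrow> real \<Rightarrow> complex" where
  "lcm_gcd_sum f k x =
     (\<Sum>n \<in> {1..k} \<rightarrow>\<^sub>E {m :: nat. 1 \<le> m \<and> real m \<le> x}.
        f (Lcm (n ` {1..k}) div Gcd (n ` {1..k})))"

definition local_term :: "(nat \<Rightarrow> complex) \<Rightarrow> real \<Rightarrow> nat \<Rightarrow> nat \<Rightarrow> (nat \<Rightarrow> nat) \<Rightarrow> complex" where
  "local_term f r k p \<nu> =
     f (p ^ (Max (\<nu> ` {1..k}) - Min (\<nu> ` {1..k}))) /
     of_real (real p powr ((r + 1) * real (\<Sum>i\<in>{1..k}. \<nu> i)))"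

definition exponent_tuples :: "nat \<Rightarrow> (nat \<Rightarrow> nat) set" where
  "exponent_tuples k = {1..k} \<rightarrow>\<^sub>E UNIV"

text \<open>
  A product over the primes is a product over all naturals in which the factors at
  non-primes are 1.
\<close>

definition euler_factor :: "(nat \<Rightarrow> complex) \<Rightarrow> real \<Rightarrow> nat \<Rightarrow> nat \<Rightarrow> complex" where
  "euler_factor f r k p =
     (if prime p
      then of_real ((1 - 1 / real p) ^ k) * (\<Sum>\<^sub>\<infinity>\<nu>\<in>exponent_tuples k. local_term f r k p \<nu>)
      else 1)"

definition D_const :: "(nat \<Rightarrow> complex) \<Rightarrow> real \<Rightarrow> nat \<Rightarrow> complex" where
  "D_const f r k = (\<Prod>p. euler_factor f r k p)"

end

theory Submission imports Defs begin

text \<open>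
  Dividing \<open>f(lcm/gcd)\<close> by \<open>(n\<^sub>1\<cdots>n\<^sub>k)\<^sup>r\<close> gives a multiplicative function of \<open>k\<close> variables that is the
  convolution of the constant 1 with some \<open>G\<close>, whose local factors are the \<open>k\<close>-fold mixed differences of
  the local factors of that function. By (i) and (ii) the local factors of \<open>G\<close> are
  \<open>O(p\<^bsup>-1/2\<^esup>)\<close> at exponent vectors of weight 1 and \<open>O(1)\<close> at all others, so
  \<open>\<Sum> |G(d)| (d\<^sub>1\<cdots>d\<^sub>k)\<^bsup>-s\<^esup>\<close> converges for every \<open>s > 1/2\<close>, and at \<open>s = 1\<close> the Euler product of
  \<open>\<Sum> G(d) (d\<^sub>1\<cdots>d\<^sub>k)\<^bsup>-1\<^esup>\<close> is the constant \<open>D\<close>. Interchanging summations turns the sum over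
  \<open>n\<close> into \<open>\<Sum> G(d) \<Prod>\<^sub>i T(x, d\<^sub>i)\<close>, where \<open>T(x, d)\<close> is the sum of \<open>n\<^sup>r\<close> over the multiples
  \<open>n \<le> x\<close> of \<open>d\<close>; replacing \<open>T(x, d)\<close> by \<open>x\<^bsup>r+1\<^esup> / ((r+1) d)\<close> costs \<open>O(x\<^bsup>r+s\<^esup> d\<^bsup>-s\<^esup>)\<close>.
\<close>

section \<open>Euler products in several variables\<close>

no_notation Infinite_Set_Sum.abs_summable_on (infix "abs'_summable'_on" 50)

text \<open>The restriction to \<open>I\<close> makes every exponent vector an element of
  \<open>I \<rightarrow>\<^sub>E UNIV\<close>, so that equality is equality on \<open>I\<close> and
  sums over vectors count each one once.\<close>

definition exps :: "'i set \<Rightarrow> ('i \<Rightarrow> nat) \<Rightarrow> nat \<Rightarrow> ('i \<Rightarrow> nat)" where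
  "exps I d p = (\<lambda>i\<in>I. multiplicity p (d i))"

definition tuple_primes :: "'i set \<Rightarrow> ('i \<Rightarrow> nat) \<Rightarrow> nat set" where
  "tuple_primes I d = (\<Union>i\<in>I. prime_factors (d i))"

text \<open>The multiplicative function of several variables with local factors \<open>a p\<close>.
  Only primes dividing some component enter, so the product is finite; it equals the product over
  all primes as soon as each \<open>a p\<close> is 1 at the zero vector.\<close>

definition euler_ext ::
  "'i set \<Rightarrow> (nat \<Rightarrow> ('i \<Rightarrow> nat) \<Rightarrow> 'a :: comm_monoid_mult) \<Rightarrow> ('i \<Rightarrow> nat) \<Rightarrow> 'a" where
  "euler_ext I a d = (\<Prod>p\<in>tuple_primes I d. a p (exps I d p))"

definition tuple_of :: "'i set \<Rightarrow> nat set \<Rightarrow> (nat \<Rightarrow> 'i \<Rightarrow> nat) \<Rightarrow> ('i \<Rightarrow> nat)" where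
  "tuple_of I P \<nu> = (\<lambda>i\<in>I. \<Prod>p\<in>P. p ^ \<nu> p i)"

text \<open>The sets \<open>B p\<close> prescribe the admissible exponent vectors prime by prime.
  One notion thus covers all tuples built from the primes in \<open>P\<close> (no restriction), the
  divisors of a tuple (boxes), and finite envelopes of a given finite set.\<close>

definition smooth_tuples ::
  "'i set \<Rightarrow> nat set \<Rightarrow> (nat \<Rightarrow> ('i \<Rightarrow> nat) set) \<Rightarrow> ('i \<Rightarrow> nat) set" where
  "smooth_tuples I P B =
     {d \<in> I \<rightarrow>\<^sub>E {0<..}. tuple_primes I d \<subseteq> P \<and> (\<forall>p\<in>P. exps I d p \<in> B p)}"

lemma finite_tuple_primes [intro]: "finite I \<Longrightarrow> finite (tuple_primes I d)"
  by (simp add: tuple_primes_def)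

lemma prime_tuple_primes: "p \<in> tuple_primes I d \<Longrightarrow> prime p"
  by (auto simp: tuple_primes_def)

lemma exps_in [intro]: "exps I d p \<in> I \<rightarrow>\<^sub>E UNIV"
  by (simp add: exps_def)

lemma exps_apply [simp]: "i \<in> I \<Longrightarrow> exps I d p i = multiplicity p (d i)"
  by (simp add: exps_def)

lemma exps_eq_0: "prime p \<Longrightarrow> p \<notin> tuple_primes I d \<Longrightarrow> exps I d p = (\<lambda>i\<in>I. 0)"
  by (auto simp: tuple_primes_def exps_def prime_factors_multiplicity fun_eq_iff)

lemma euler_ext_superset:
  assumes "finite P" "\<And>p. p \<in> P \<Longrightarrow> prime p" "\<And>p. p \<in> P \<Longrightarrow> a p (\<lambda>i\<in>I. 0) = 1"
    "tuple_primes I d \<subseteq> P"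
  shows "euler_ext I a d = (\<Prod>p\<in>P. a p (exps I d p))"
  unfolding euler_ext_def
proof (rule prod.mono_neutral_left)
  show "\<forall>p\<in>P - tuple_primes I d. a p (exps I d p) = 1"
    using assms(2,3) by (metis Diff_iff exps_eq_0)
qed (fact assms)+

lemma exps_tuple_of:
  assumes "finite P" "\<And>p. p \<in> P \<Longrightarrow> prime p" "p \<in> P" "\<nu> p \<in> I \<rightarrow>\<^sub>E UNIV"
  shows "exps I (tuple_of I P \<nu>) p = \<nu> p"
proof
  fix i show "exps I (tuple_of I P \<nu>) p i = \<nu> p i"
    using assms PiE_arb[OF assms(4), of i]
    by (auto simp: exps_def tuple_of_def multiplicity_prod_prime_powers)
qed

lemma tuple_primes_tuple_of:
  assumes "finite P" "\<And>p. p \<in> P \<Longrightarrow> prime p"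
  shows "tuple_primes I (tuple_of I P \<nu>) \<subseteq> P"
proof
  fix q assume "q \<in> tuple_primes I (tuple_of I P \<nu>)"
  then obtain i where "i \<in> I" "prime q" "multiplicity q (\<Prod>p\<in>P. p ^ \<nu> p i) > 0"
    by (auto simp: tuple_primes_def tuple_of_def prime_factors_multiplicity)
  then show "q \<in> P"
    using assms by (auto simp: multiplicity_prod_prime_powers split: if_splits)
qed

lemma tuple_of_exps:
  assumes "finite P" "\<And>p. p \<in> P \<Longrightarrow> prime p" "d \<in> I \<rightarrow>\<^sub>E {0<..}" "tuple_primes I d \<subseteq> P"
  shows "tuple_of I P (\<lambda>p\<in>P. exps I d p) = d"
proof
  fix i show "tuple_of I P (\<lambda>p\<in>P. exps I d p) i = d i"
  proof (cases "i \<in> I")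
    case True
    then have "d i > 0" "prime_factors (d i) \<subseteq> P"
      using assms by (auto simp: tuple_primes_def PiE_def Pi_def)
    have "d i = (\<Prod>p\<in>prime_factors (d i). p ^ multiplicity p (d i))"
      using \<open>d i > 0\<close> by (simp add: prime_factorization_nat)
    also have "\<dots> = (\<Prod>p\<in>P. p ^ multiplicity p (d i))"
      by (rule prod.mono_neutral_left)
        (use assms \<open>prime_factors (d i) \<subseteq> P\<close> in \<open>auto simp: prime_factors_multiplicity\<close>)
    finally show ?thesis using True by (simp add: tuple_of_def)
  next
    case False then show ?thesis using PiE_arb[OF assms(3)] by (simp add: tuple_of_def)
  qed
qed

text \<open>Unique factorization in every coordinate: a smooth tuple amounts to an independent
  choice of one exponent vector for each prime in \<open>P\<close>.\<close>

lemma bij_betw_tuple_of: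
  assumes "finite P" "\<And>p. p \<in> P \<Longrightarrow> prime p" "\<And>p. p \<in> P \<Longrightarrow> B p \<subseteq> I \<rightarrow>\<^sub>E UNIV"
  shows "bij_betw (tuple_of I P) (PiE P B) (smooth_tuples I P B)"
proof (rule bij_betw_byWitness[where f' = "\<lambda>d. \<lambda>p\<in>P. exps I d p"])
  have exps: "exps I (tuple_of I P \<nu>) p = \<nu> p" if "\<nu> \<in> PiE P B" "p \<in> P" for \<nu> p
    using that assms(3)[of p] by (intro exps_tuple_of assms) (auto dest: PiE_mem)
  show "\<forall>\<nu>\<in>Pi\<^sub>E P B. (\<lambda>p\<in>P. exps I (tuple_of I P \<nu>) p) = \<nu>"
    by (auto simp: fun_eq_iff exps restrict_def dest: PiE_arb)
  show "\<forall>d\<in>smooth_tuples I P B. tuple_of I P (restrict (exps I d) P) = d"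
    using assms by (auto simp: smooth_tuples_def intro!: tuple_of_exps)
  show "tuple_of I P ` Pi\<^sub>E P B \<subseteq> smooth_tuples I P B"
  proof
    fix d assume "d \<in> tuple_of I P ` Pi\<^sub>E P B"
    then obtain \<nu> where \<nu>: "\<nu> \<in> PiE P B" "d = tuple_of I P \<nu>" by auto
    have "d \<in> I \<rightarrow>\<^sub>E {0<..}"
      unfolding \<nu> tuple_of_def using assms(2)
      by (auto intro!: prod_pos simp: prime_gt_0_nat)
    moreover have "tuple_primes I d \<subseteq> P"
      unfolding \<nu> by (rule tuple_primes_tuple_of) (use assms in auto)
    ultimately show "d \<in> smooth_tuples I P B"
      using \<nu> exps by (auto simp: smooth_tuples_def dest: PiE_mem)
  qed
  show "(\<lambda>d. restrict (exps I d) P) ` smooth_tuples I P B \<subseteq> Pi\<^sub>E P B"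
    by (auto simp: smooth_tuples_def)
qed

text \<open>The finite Euler product: after reindexing by exponent vectors the sum runs over a
  product set, and its terms are products of functions of one prime each.\<close>

lemma infsum_euler_ext:
  fixes a :: "nat \<Rightarrow> ('i \<Rightarrow> nat) \<Rightarrow> 'a :: {banach, real_normed_div_algebra, comm_ring_1}"
  assumes "finite P" "\<And>p. p \<in> P \<Longrightarrow> prime p" "\<And>p. p \<in> P \<Longrightarrow> B p \<subseteq> I \<rightarrow>\<^sub>E UNIV"
    "\<And>p. p \<in> P \<Longrightarrow> a p (\<lambda>i\<in>I. 0) = 1" "\<And>p. p \<in> P \<Longrightarrow> a p abs_summable_on B p"
  shows "infsum (euler_ext I a) (smooth_tuples I P B) = (\<Prod>p\<in>P. infsum (a p) (B p))"
proof -
  have "infsum (euler_ext I a) (smooth_tuples I P B) =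
        infsum (\<lambda>\<nu>. euler_ext I a (tuple_of I P \<nu>)) (PiE P B)"
    by (rule infsum_reindex_bij_betw[symmetric]) (intro bij_betw_tuple_of assms)
  also have "\<dots> = infsum (\<lambda>\<nu>. \<Prod>p\<in>P. a p (\<nu> p)) (PiE P B)"
  proof (rule infsum_cong)
    fix \<nu> assume \<nu>: "\<nu> \<in> PiE P B"
    have "euler_ext I a (tuple_of I P \<nu>) = (\<Prod>p\<in>P. a p (exps I (tuple_of I P \<nu>) p))"
      using assms by (intro euler_ext_superset tuple_primes_tuple_of) auto
    also have "\<dots> = (\<Prod>p\<in>P. a p (\<nu> p))"
    proof (rule prod.cong)
      fix p assume "p \<in> P"
      then have "exps I (tuple_of I P \<nu>) p = \<nu> p"
        using assms(3)[of p] \<nu> by (intro exps_tuple_of assms) (auto dest: PiE_mem)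
      then show "a p (exps I (tuple_of I P \<nu>) p) = a p (\<nu> p)" by simp
    qed simp
    finally show "euler_ext I a (tuple_of I P \<nu>) = (\<Prod>p\<in>P. a p (\<nu> p))" .
  qed
  also have "\<dots> = (\<Prod>p\<in>P. infsum (a p) (B p))"
    by (rule infsum_prod_PiE_abs) (use assms in auto)
  finally show ?thesis .
qed

lemma finite_smooth_tuples:
  assumes "finite P" "\<And>p. p \<in> P \<Longrightarrow> prime p" "\<And>p. p \<in> P \<Longrightarrow> B p \<subseteq> I \<rightarrow>\<^sub>E UNIV"
    "\<And>p. p \<in> P \<Longrightarrow> finite (B p)"
  shows "finite (smooth_tuples I P B)"
  using bij_betw_finite[OF bij_betw_tuple_of[OF assms(1-3)]] assms by (simp add: finite_PiE)

lemma sum_euler_ext: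
  fixes a :: "nat \<Rightarrow> ('i \<Rightarrow> nat) \<Rightarrow> 'a :: {banach, real_normed_div_algebra, comm_ring_1}"
  assumes "finite P" "\<And>p. p \<in> P \<Longrightarrow> prime p" "\<And>p. p \<in> P \<Longrightarrow> B p \<subseteq> I \<rightarrow>\<^sub>E UNIV"
    "\<And>p. p \<in> P \<Longrightarrow> a p (\<lambda>i\<in>I. 0) = 1" "\<And>p. p \<in> P \<Longrightarrow> finite (B p)"
  shows "sum (euler_ext I a) (smooth_tuples I P B) = (\<Prod>p\<in>P. sum (a p) (B p))"
  using infsum_euler_ext[of P B I a] finite_smooth_tuples[of P B I] assms by simp

lemma norm_euler_ext:
  fixes a :: "nat \<Rightarrow> ('i \<Rightarrow> nat) \<Rightarrow> 'a :: {real_normed_div_algebra, comm_ring_1}"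
  shows "norm (euler_ext I a d) = euler_ext I (\<lambda>p \<nu>. norm (a p \<nu>)) d"
  by (simp add: euler_ext_def prod_norm)

lemma euler_ext_mult:
  "euler_ext I (\<lambda>p \<nu>. a p \<nu> * b p \<nu>) d = euler_ext I a d * euler_ext I b d"
  by (simp add: euler_ext_def prod.distrib)

text \<open>Every finite partial sum is dominated by a finite Euler product, hence by the product of
  the \<open>1 + b p\<close> and by \<open>exp (suminf b)\<close>, a bound independent of the
  partial sum.\<close>

lemma abs_summable_euler_ext:
  fixes a :: "nat \<Rightarrow> ('i \<Rightarrow> nat) \<Rightarrow> 'a :: {banach, real_normed_div_algebra, comm_ring_1}"
  assumes "finite I" "\<And>p. prime p \<Longrightarrow> a p (\<lambda>i\<in>I. 0) = 1" "\<And>p. b p \<ge> 0" "summable b"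
    "\<And>p B. prime p \<Longrightarrow> finite B \<Longrightarrow> B \<subseteq> (I \<rightarrow>\<^sub>E UNIV) \<Longrightarrow> (\<Sum>\<nu>\<in>B. norm (a p \<nu>)) \<le> 1 + b p"
  shows "euler_ext I a abs_summable_on (I \<rightarrow>\<^sub>E {0<..})"
  unfolding abs_summable_iff_bdd_above
proof (rule bdd_aboveI2)
  fix D assume "D \<in> {F. F \<subseteq> I \<rightarrow>\<^sub>E {0 :: nat<..} \<and> finite F}"
  then have D: "D \<subseteq> I \<rightarrow>\<^sub>E {0<..}" "finite D" by auto
  define P where "P = (\<Union>d\<in>D. tuple_primes I d)"
  \<comment> \<open>Collecting only the primes and exponent vectors that occur in \<open>D\<close>
    encloses \<open>D\<close> in a finite set over which the sum factors.\<close>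
  define B where "B p = (\<lambda>d. exps I d p) ` D" for p
  have P: "finite P" "\<And>p. p \<in> P \<Longrightarrow> prime p"
    using D assms(1) by (auto simp: P_def prime_tuple_primes)
  have B: "B p \<subseteq> I \<rightarrow>\<^sub>E UNIV" "finite (B p)" for p
    using D by (auto simp: B_def exps_def)
  have "(\<Sum>d\<in>D. norm (euler_ext I a d)) \<le> (\<Sum>d\<in>smooth_tuples I P B. norm (euler_ext I a d))"
  proof (rule sum_mono2)
    show "finite (smooth_tuples I P B)" by (rule finite_smooth_tuples) (use P B in auto)
    show "D \<subseteq> smooth_tuples I P B" using D by (auto simp: P_def B_def smooth_tuples_def)
  qed simp
  also have "\<dots> = sum (euler_ext I (\<lambda>p \<nu>. norm (a p \<nu>))) (smooth_tuples I P B)"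
    by (simp add: norm_euler_ext)
  also have "\<dots> = (\<Prod>p\<in>P. \<Sum>\<nu>\<in>B p. norm (a p \<nu>))"
    by (rule sum_euler_ext) (use P B assms in auto)
  also have "\<dots> \<le> (\<Prod>p\<in>P. 1 + b p)"
    by (rule prod_mono) (use P B assms in \<open>auto intro!: sum_nonneg\<close>)
  also have "\<dots> \<le> exp (sum b P)" by (rule prod_le_exp_sum) (rule assms)
  also have "\<dots> \<le> exp (suminf b)"
    using sum_le_suminf[OF assms(4) P(1)] assms(3) by simp
  finally show "(\<Sum>d\<in>D. norm (euler_ext I a d)) \<le> exp (suminf b)" .
qed

section \<open>Infinite Euler products as limits of finite ones\<close>

lemma infsum_tendsto_exhaustion:
  fixes f :: "'b \<Rightarrow> 'a :: banach"
  assumes "f summable_on A" "\<And>n. S n \<subseteq> A" "\<And>x. x \<in> A \<Longrightarrow> \<forall>\<^sub>F n in sequentially. x \<in> S n"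
  shows "(\<lambda>n. infsum f (S n)) \<longlonglongrightarrow> infsum f A"
proof (rule tendstoI)
  fix e :: real assume "e > 0"
  have "(sum f \<longlongrightarrow> infsum f A) (finite_subsets_at_top A)"
    using assms(1) by (metis has_sum_def has_sum_infsum)
  then have "\<forall>\<^sub>F F in finite_subsets_at_top A. dist (sum f F) (infsum f A) < e / 2"
    using \<open>e > 0\<close> by (intro tendstoD) auto
  then obtain F0 where F0: "finite F0" "F0 \<subseteq> A"
    "\<forall>F. finite F \<and> F0 \<subseteq> F \<and> F \<subseteq> A \<longrightarrow> dist (sum f F) (infsum f A) < e / 2"
    by (auto simp: eventually_finite_subsets_at_top)
  \<comment> \<open>The sets \<open>S n\<close> may be infinite and need not increase; it suffices
    that the finite set \<open>F0\<close>, beyond which all finite sums are close to the total, is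
    eventually contained in them.\<close>
  have "\<forall>\<^sub>F n in sequentially. \<forall>x\<in>F0. x \<in> S n"
    using F0 assms(3) by (intro eventually_ball_finite) auto
  then show "\<forall>\<^sub>F n in sequentially. dist (infsum f (S n)) (infsum f A) < e"
  proof eventually_elim
    case (elim n)
    have "f summable_on S n" using assms(1,2) by (rule summable_on_subset_banach)
    then have lim: "(sum f \<longlongrightarrow> infsum f (S n)) (finite_subsets_at_top (S n))"
      by (metis has_sum_def has_sum_infsum)
    \<comment> \<open>Passing to the limit over the finite subsets of \<open>S n\<close> preserves
      only a weak inequality, hence the margin \<open>e / 2\<close>.\<close>
    have "\<forall>\<^sub>F F in finite_subsets_at_top (S n). dist (sum f F) (infsum f A) \<le> e / 2"
      unfolding eventually_finite_subsets_at_top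
    proof (intro exI[of _ F0] conjI allI impI)
      fix F assume "finite F \<and> F0 \<subseteq> F \<and> F \<subseteq> S n"
      then show "dist (sum f F) (infsum f A) \<le> e / 2"
        using F0(3) assms(2)[of n] by (meson less_imp_le subset_trans)
    qed (use F0 elim in auto)
    then have "dist (infsum f (S n)) (infsum f A) \<le> e / 2"
      by (intro tendsto_upperbound[OF tendsto_dist[OF lim tendsto_const]]) auto
    then show ?case using \<open>e > 0\<close> by simp
  qed
qed

text \<open>The partial product up to \<open>n\<close> is the sum over the tuples all of whose
  primes are at most \<open>n\<close>, and these sets exhaust all tuples. Factors 1 at non-primes
  match the form of an infinite product over the naturals.\<close>

lemma euler_product_tendsto:
  fixes a :: "nat \<Rightarrow> ('i \<Rightarrow> nat) \<Rightarrow> 'a :: {banach, real_normed_div_algebra, comm_ring_1}"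
  assumes "finite I" "\<And>p. prime p \<Longrightarrow> a p (\<lambda>i\<in>I. 0) = 1"
    "\<And>p. prime p \<Longrightarrow> a p abs_summable_on (I \<rightarrow>\<^sub>E UNIV)"
    "euler_ext I a abs_summable_on (I \<rightarrow>\<^sub>E {0<..})"
  shows "(\<lambda>n. \<Prod>p\<le>n. if prime p then infsum (a p) (I \<rightarrow>\<^sub>E UNIV) else 1)
           \<longlonglongrightarrow> infsum (euler_ext I a) (I \<rightarrow>\<^sub>E {0<..})"
proof -
  define S where "S n = smooth_tuples I {p. p \<le> n \<and> prime p} (\<lambda>_. I \<rightarrow>\<^sub>E UNIV)" for n
  have S: "S n = {d \<in> I \<rightarrow>\<^sub>E {0<..}. tuple_primes I d \<subseteq> {..n}}" for n
    by (auto simp: S_def smooth_tuples_def exps_def dest: prime_tuple_primes)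
  have "infsum (euler_ext I a) (S n) =
      (\<Prod>p\<le>n. if prime p then infsum (a p) (I \<rightarrow>\<^sub>E UNIV) else 1)" for n
  proof -
    have "infsum (euler_ext I a) (S n) = (\<Prod>p | p \<le> n \<and> prime p. infsum (a p) (I \<rightarrow>\<^sub>E UNIV))"
      unfolding S_def by (rule infsum_euler_ext) (use assms in auto)
    also have "\<dots> = (\<Prod>p\<le>n. if prime p then infsum (a p) (I \<rightarrow>\<^sub>E UNIV) else 1)"
      by (rule prod.mono_neutral_cong_left) auto
    finally show ?thesis .
  qed
  moreover have "(\<lambda>n. infsum (euler_ext I a) (S n)) \<longlonglongrightarrow> infsum (euler_ext I a) (I \<rightarrow>\<^sub>E {0<..})"
  proof (rule infsum_tendsto_exhaustion)
    show "euler_ext I a summable_on (I \<rightarrow>\<^sub>E {0<..})"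
      using assms(4) by (rule abs_summable_summable)
    show "S n \<subseteq> I \<rightarrow>\<^sub>E {0<..}" for n by (auto simp: S)
    fix d :: "'i \<Rightarrow> nat" assume d: "d \<in> I \<rightarrow>\<^sub>E {0<..}"
    obtain N where "tuple_primes I d \<subseteq> {..N}"
      using finite_tuple_primes[OF assms(1)] by (metis finite_nat_iff_bounded_le)
    then show "\<forall>\<^sub>F n in sequentially. d \<in> S n"
      unfolding eventually_sequentially S using d by (intro exI[of _ N]) auto
  qed
  ultimately show ?thesis by simp
qed

section \<open>Mixed differences\<close>

text \<open>The operator \<open>1 - shift\<close>, applied once in each coordinate, where
  \<open>h\<close> counts as 0 at negative exponents. Keeping \<open>E\<close> within the positive
  coordinates realises this convention and keeps the natural subtraction exact. On Euler extensions
  it is Dirichlet convolution with the Moebius function in each variable.\<close>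

definition mixed_diff :: "'i set \<Rightarrow> (('i \<Rightarrow> nat) \<Rightarrow> 'a :: comm_ring_1) \<Rightarrow> ('i \<Rightarrow> nat) \<Rightarrow> 'a" where
  "mixed_diff I h \<nu> =
     (\<Sum>E\<in>Pow {i \<in> I. \<nu> i > 0}. (-1) ^ card E * h (\<lambda>i\<in>I. \<nu> i - of_bool (i \<in> E)))"

lemma mixed_diff_0 [simp]: "mixed_diff I h (\<lambda>i\<in>I. 0) = h (\<lambda>i\<in>I. 0)"
proof -
  have "{i \<in> I. (\<lambda>i\<in>I. 0 :: nat) i > 0} = {}" by auto
  moreover have "(\<lambda>i\<in>I. (\<lambda>i\<in>I. 0) i - of_bool (i \<in> {})) = (\<lambda>i\<in>I. 0 :: nat)"
    by (auto simp: fun_eq_iff)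
  ultimately show ?thesis by (simp add: mixed_diff_def)
qed

lemma sum_Pow_alternating:
  fixes S :: "'i set"
  assumes "finite S"
  shows "(\<Sum>E\<in>Pow S. (-1) ^ card E) = (if S = {} then 1 else 0 :: 'a :: comm_ring_1)"
  using prod_add[OF assms, of "\<lambda>_. -1 :: 'a" "\<lambda>_. 1"] assms
  by (cases "S = {}") (auto simp: power_0_left)

text \<open>Moebius inversion on a box. Grouping the terms by the shifted vector leaves, as
  coefficient of \<open>h \<mu>\<close>, an alternating sum over the subsets of the coordinates
  where \<open>\<mu>\<close> lies below \<open>\<nu>\<close>; it vanishes unless there are
  none.\<close>

lemma sum_mixed_diff:
  fixes h :: "('i \<Rightarrow> nat) \<Rightarrow> 'a :: comm_ring_1"
  assumes "finite I" "\<nu> \<in> I \<rightarrow>\<^sub>E UNIV"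
  shows "(\<Sum>\<mu>\<in>PiE I (\<lambda>i. {..\<nu> i}). mixed_diff I h \<mu>) = h \<nu>"
proof -
  define B where "B = PiE I (\<lambda>i. {..\<nu> i})"
  have [simp]: "finite B" using assms(1) by (simp add: B_def finite_PiE)
  have "(\<Sum>\<mu>\<in>B. mixed_diff I h \<mu>) =
      (\<Sum>(\<mu>, E)\<in>(SIGMA \<mu>:B. Pow {i \<in> I. \<mu> i > 0}).
         (-1) ^ card E * h (\<lambda>i\<in>I. \<mu> i - of_bool (i \<in> E)))"
    unfolding mixed_diff_def using assms(1) by (subst sum.Sigma) auto
  also have "\<dots> = (\<Sum>(\<mu>, E)\<in>(SIGMA \<mu>:B. Pow {i \<in> I. \<mu> i < \<nu> i}). (-1) ^ card E * h \<mu>)"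
  \<comment> \<open>Lowering \<open>\<mu>\<close> by 1 on \<open>E\<close> turns the condition that
    \<open>\<mu>\<close> is positive on \<open>E\<close> into the condition that the new vector is
    still below \<open>\<nu>\<close> there.\<close>
  proof (rule sum.reindex_bij_witness[where
      i = "\<lambda>(\<mu>, E). (\<lambda>i\<in>I. \<mu> i + of_bool (i \<in> E), E)" and
      j = "\<lambda>(\<mu>, E). (\<lambda>i\<in>I. \<mu> i - of_bool (i \<in> E), E)"])
    fix x assume "x \<in> (SIGMA \<mu>:B. Pow {i \<in> I. \<mu> i > 0})"
    then obtain \<mu> E where x: "x = (\<mu>, E)" "\<mu> \<in> B" "E \<subseteq> {i \<in> I. \<mu> i > 0}" by auto
    then have "(\<lambda>i\<in>I. (\<lambda>i\<in>I. \<mu> i - of_bool (i \<in> E)) i + of_bool (i \<in> E)) = \<mu>"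
      by (auto simp: B_def fun_eq_iff PiE_iff extensional_def of_bool_def)
    then show "(case case x of (\<mu>, E) \<Rightarrow> (\<lambda>i\<in>I. \<mu> i - of_bool (i \<in> E), E) of
        (\<mu>, E) \<Rightarrow> (\<lambda>i\<in>I. \<mu> i + of_bool (i \<in> E), E)) = x"
      by (simp add: x)
    show "(case x of (\<mu>, E) \<Rightarrow> (\<lambda>i\<in>I. \<mu> i - of_bool (i \<in> E), E))
        \<in> (SIGMA \<mu>:B. Pow {i \<in> I. \<mu> i < \<nu> i})"
      using x by (fastforce simp: B_def PiE_iff of_bool_def)
  next
    fix x assume "x \<in> (SIGMA \<mu>:B. Pow {i \<in> I. \<mu> i < \<nu> i})"
    then obtain \<mu> E where x: "x = (\<mu>, E)" "\<mu> \<in> B" "E \<subseteq> {i \<in> I. \<mu> i < \<nu> i}" by auto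
    then have "(\<lambda>i\<in>I. (\<lambda>i\<in>I. \<mu> i + of_bool (i \<in> E)) i - of_bool (i \<in> E)) = \<mu>"
      by (auto simp: B_def fun_eq_iff PiE_iff extensional_def)
    then show "(case case x of (\<mu>, E) \<Rightarrow> (\<lambda>i\<in>I. \<mu> i + of_bool (i \<in> E), E) of
        (\<mu>, E) \<Rightarrow> (\<lambda>i\<in>I. \<mu> i - of_bool (i \<in> E), E)) = x"
      by (simp add: x)
    show "(case x of (\<mu>, E) \<Rightarrow> (\<lambda>i\<in>I. \<mu> i + of_bool (i \<in> E), E))
        \<in> (SIGMA \<mu>:B. Pow {i \<in> I. \<mu> i > 0})"
      using x by (fastforce simp: B_def PiE_iff of_bool_def)
  qed auto
  also have "\<dots> = (\<Sum>\<mu>\<in>B. (\<Sum>E\<in>Pow {i \<in> I. \<mu> i < \<nu> i}. (-1) ^ card E) * h \<mu>)"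
    using assms(1) by (subst sum.Sigma[symmetric]) (auto simp: sum_distrib_right)
  also have "\<dots> = (\<Sum>\<mu>\<in>B. if \<mu> = \<nu> then h \<mu> else 0)"
  proof (rule sum.cong)
    fix \<mu> assume \<mu>: "\<mu> \<in> B"
    have "\<mu> = \<nu>" if "{i \<in> I. \<mu> i < \<nu> i} = {}"
    proof
      fix i show "\<mu> i = \<nu> i"
      proof (cases "i \<in> I")
        case True
        then have "\<mu> i \<le> \<nu> i" "\<not> \<mu> i < \<nu> i" using \<mu> that by (auto simp: B_def)
        then show ?thesis by simp
      qed (use \<mu> assms(2) in \<open>auto simp: B_def PiE_iff extensional_def\<close>)
    qed
    then have "{i \<in> I. \<mu> i < \<nu> i} = {} \<longleftrightarrow> \<mu> = \<nu>" by auto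
    then show "(\<Sum>E\<in>Pow {i \<in> I. \<mu> i < \<nu> i}. (-1) ^ card E) * h \<mu> = (if \<mu> = \<nu> then h \<mu> else 0)"
      using sum_Pow_alternating[of "{i \<in> I. \<mu> i < \<nu> i}", where 'a = 'a] assms(1) by simp
  qed simp
  also have "\<dots> = h \<nu>"
  proof -
    have "\<nu> \<in> B" using assms(2) by (simp add: B_def PiE_iff)
    then show ?thesis by simp
  qed
  finally show ?thesis by (simp add: B_def)
qed

lemma has_sum_sum:
  fixes g :: "'b \<Rightarrow> 'c \<Rightarrow> 'a :: topological_comm_monoid_add"
  assumes "\<And>E. E \<in> J \<Longrightarrow> (g E has_sum s E) A"
  shows "((\<lambda>x. \<Sum>E\<in>J. g E x) has_sum (\<Sum>E\<in>J. s E)) A"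
  using assms by (induction J rule: infinite_finite_induct) (auto intro!: has_sum_add has_sum_0)

text \<open>On generating functions a shift along \<open>E\<close> is multiplication by
  \<open>w ^ card E\<close>, so the signed sum over \<open>E\<close> multiplies by
  \<open>(1 - w) ^ card I\<close>. At \<open>w = 1/p\<close> this produces the power of
  \<open>1 - 1/p\<close> in the constant.\<close>

lemma has_sum_mixed_diff:
  fixes h :: "('i \<Rightarrow> nat) \<Rightarrow> 'a :: real_normed_field"
  assumes "finite I" "((\<lambda>\<nu>. h \<nu> * w ^ sum \<nu> I) has_sum H) (I \<rightarrow>\<^sub>E UNIV)"
  shows "((\<lambda>\<nu>. mixed_diff I h \<nu> * w ^ sum \<nu> I) has_sum ((1 - w) ^ card I * H)) (I \<rightarrow>\<^sub>E UNIV)"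
proof -
  \<comment> \<open>Extension by 0 lets each \<open>E\<close> contribute a sum over the same index
    set, so that the finitely many sums can be added.\<close>
  define g where "g E \<nu> = (if E \<subseteq> {i \<in> I. \<nu> i > 0} then
      (-1) ^ card E * h (\<lambda>i\<in>I. \<nu> i - of_bool (i \<in> E)) * w ^ sum \<nu> I else 0)" for E and \<nu> :: "'i \<Rightarrow> nat"
  have "(g E has_sum ((-w) ^ card E * H)) (I \<rightarrow>\<^sub>E UNIV)" if E: "E \<subseteq> I" for E
  proof -
    have "sum (\<lambda>i\<in>I. \<mu> i + of_bool (i \<in> E)) I = card E + sum \<mu> I" for \<mu> :: "'i \<Rightarrow> nat"
    proof -
      have "I \<inter> E = E" using E by auto
      then show ?thesis using assms(1) by (simp add: sum.distrib of_bool_def sum.If_cases)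
    qed
    moreover have "((\<lambda>\<mu>. (-w) ^ card E * (h \<mu> * w ^ sum \<mu> I)) has_sum ((-w) ^ card E * H)) (I \<rightarrow>\<^sub>E UNIV)"
      by (rule has_sum_cmult_right) (rule assms)
    ultimately have "(g E has_sum ((-w) ^ card E * H)) {\<nu> \<in> I \<rightarrow>\<^sub>E UNIV. E \<subseteq> {i \<in> I. \<nu> i > 0}}"
    proof (subst has_sum_reindex_bij_witness[where
        i = "\<lambda>\<mu>. \<lambda>i\<in>I. \<mu> i + of_bool (i \<in> E)" and j = "\<lambda>\<nu>. \<lambda>i\<in>I. \<nu> i - of_bool (i \<in> E)"])
      fix \<nu> :: "'i \<Rightarrow> nat" assume \<nu>: "\<nu> \<in> {\<nu> \<in> I \<rightarrow>\<^sub>E UNIV. E \<subseteq> {i \<in> I. \<nu> i > 0}}"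
      show inv: "(\<lambda>i\<in>I. (\<lambda>i\<in>I. \<nu> i - of_bool (i \<in> E)) i + of_bool (i \<in> E)) = \<nu>"
        using \<nu> by (auto simp: fun_eq_iff PiE_iff extensional_def of_bool_def)
      assume eq: "\<And>\<mu> :: 'i \<Rightarrow> nat. sum (\<lambda>i\<in>I. \<mu> i + of_bool (i \<in> E)) I = card E + sum \<mu> I"
      have "sum \<nu> I = card E + sum (\<lambda>i\<in>I. \<nu> i - of_bool (i \<in> E)) I"
        using eq[of "\<lambda>i\<in>I. \<nu> i - of_bool (i \<in> E)"] by (simp only: inv)
      then show "(- w) ^ card E * (h (\<lambda>i\<in>I. \<nu> i - of_bool (i \<in> E)) *
          w ^ sum (\<lambda>i\<in>I. \<nu> i - of_bool (i \<in> E)) I) = g E \<nu>"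
        using \<nu> by (simp add: g_def power_add power_minus[of w])
    next
      fix \<mu> :: "'i \<Rightarrow> nat" assume \<mu>: "\<mu> \<in> I \<rightarrow>\<^sub>E UNIV"
      show "(\<lambda>i\<in>I. (\<lambda>i\<in>I. \<mu> i + of_bool (i \<in> E)) i - of_bool (i \<in> E)) = \<mu>"
        using \<mu> by (auto simp: fun_eq_iff PiE_iff extensional_def)
      show "(\<lambda>i\<in>I. \<mu> i + of_bool (i \<in> E)) \<in> {\<nu> \<in> I \<rightarrow>\<^sub>E UNIV. E \<subseteq> {i \<in> I. \<nu> i > 0}}"
        using E by auto
    qed (auto)
    then show ?thesis
      by (rule has_sum_cong_neutral[THEN iffD1, rotated -1]) (auto simp: g_def)
  qed
  then have "((\<lambda>\<nu>. \<Sum>E\<in>Pow I. g E \<nu>) has_sum (\<Sum>E\<in>Pow I. (-w) ^ card E * H)) (I \<rightarrow>\<^sub>E UNIV)"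
    by (intro has_sum_sum) auto
  also have "(\<Sum>E\<in>Pow I. (-w) ^ card E * H) = (1 - w) ^ card I * H"
    using prod_add[OF assms(1), of "\<lambda>_. -w" "\<lambda>_. 1"] by (simp add: sum_distrib_right)
  also have "(\<lambda>\<nu>. \<Sum>E\<in>Pow I. g E \<nu>) = (\<lambda>\<nu>. mixed_diff I h \<nu> * w ^ sum \<nu> I)"
  proof
    fix \<nu>
    have "(\<Sum>E\<in>Pow I. g E \<nu>) = (\<Sum>E\<in>Pow {i \<in> I. \<nu> i > 0}. g E \<nu>)"
      by (rule sum.mono_neutral_right) (use assms(1) in \<open>auto simp: g_def\<close>)
    then show "(\<Sum>E\<in>Pow I. g E \<nu>) = mixed_diff I h \<nu> * w ^ sum \<nu> I"
      by (simp add: g_def mixed_diff_def sum_distrib_right)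
  qed
  finally show ?thesis .
qed

lemma norm_mixed_diff_le:
  fixes h :: "('i \<Rightarrow> nat) \<Rightarrow> 'a :: {real_normed_algebra_1, comm_ring_1}"
  assumes "finite I" "\<And>\<mu>. \<mu> \<in> I \<rightarrow>\<^sub>E UNIV \<Longrightarrow> norm (h \<mu>) \<le> M"
  shows "norm (mixed_diff I h \<nu>) \<le> 2 ^ card I * M"
proof -
  have "M \<ge> 0" by (rule order_trans[OF norm_ge_zero assms(2)[of "\<lambda>i\<in>I. 0"]]) simp
  have "norm (mixed_diff I h \<nu>) \<le> (\<Sum>E\<in>Pow {i \<in> I. \<nu> i > 0}. M)"
    unfolding mixed_diff_def
  proof (rule sum_norm_le)
    fix E
    have "norm ((-1) ^ card E * h (\<lambda>i\<in>I. \<nu> i - of_bool (i \<in> E))) =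
        norm (h (\<lambda>i\<in>I. \<nu> i - of_bool (i \<in> E)))"
      by (cases "even (card E)") auto
    also have "\<dots> \<le> M" by (rule assms) simp
    finally show "norm ((-1) ^ card E * h (\<lambda>i\<in>I. \<nu> i - of_bool (i \<in> E))) \<le> M" .
  qed
  also have "\<dots> = 2 ^ card {i \<in> I. \<nu> i > 0} * M"
    using assms(1) by (simp add: card_Pow)
  also have "\<dots> \<le> 2 ^ card I * M"
    using assms(1) \<open>M \<ge> 0\<close> by (intro mult_right_mono power_increasing card_mono) auto
  finally show ?thesis .
qed

text \<open>At a unit vector only the empty set and one singleton contribute. This single difference
  is where the closeness of \<open>f p\<close> to the \<open>r\<close>-th power of \<open>p\<close>
  becomes visible.\<close>

lemma mixed_diff_sum_eq_1:
  assumes "finite I" "\<nu> \<in> I \<rightarrow>\<^sub>E UNIV" "sum \<nu> I = 1"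
  shows "mixed_diff I h \<nu> = h \<nu> - h (\<lambda>i\<in>I. 0)"
proof -
  obtain j where j: "j \<in> I" "\<nu> j = 1" "\<And>i. i \<in> I \<Longrightarrow> i \<noteq> j \<Longrightarrow> \<nu> i = 0"
    using assms(1,3) by (auto simp: sum_eq_Suc0_iff)
  have "{i \<in> I. \<nu> i > 0} = {j}" using j by force
  moreover have "(\<lambda>i\<in>I. \<nu> i - of_bool (i = j)) = (\<lambda>i\<in>I. 0)"
    using j by (auto simp: fun_eq_iff)
  moreover have "restrict \<nu> I = \<nu>"
    using assms(2) by (auto simp: fun_eq_iff PiE_iff extensional_def)
  ultimately show ?thesis by (simp add: mixed_diff_def Pow_insert)
qed

text \<open>The set \<open>B\<close> is enclosed in the box of its coordinate projections, where the
  sum splits into one partial geometric series per coordinate.\<close>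

lemma sum_power_sum_le:
  fixes u :: real
  assumes "finite I" "0 \<le> u" "u < 1" "finite B" "B \<subseteq> I \<rightarrow>\<^sub>E UNIV"
  shows "(\<Sum>\<nu>\<in>B. u ^ sum \<nu> I) \<le> (1 / (1 - u)) ^ card I"
proof -
  define C where "C i = (\<lambda>\<nu>. \<nu> i) ` B" for i
  have "(\<Sum>\<nu>\<in>B. u ^ sum \<nu> I) \<le> (\<Sum>\<nu>\<in>PiE I C. u ^ sum \<nu> I)"
    by (rule sum_mono2) (use assms in \<open>auto simp: C_def intro!: finite_PiE\<close>)
  also have "\<dots> = (\<Prod>i\<in>I. \<Sum>m\<in>C i. u ^ m)"
    unfolding power_sum by (rule prod_sum_PiE[symmetric]) (use assms in \<open>auto simp: C_def\<close>)
  also have "\<dots> \<le> (\<Prod>i\<in>I. 1 / (1 - u))"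
  proof (rule prod_mono, safe)
    fix i
    show "(\<Sum>m\<in>C i. u ^ m) \<ge> 0" using assms(2) by (intro sum_nonneg) auto
    have "(\<Sum>m\<in>C i. u ^ m) \<le> (\<Sum>m. u ^ m)"
      using assms by (intro sum_le_suminf) (auto simp: C_def intro!: summable_geometric)
    then show "(\<Sum>m\<in>C i. u ^ m) \<le> 1 / (1 - u)"
      using assms by (simp add: suminf_geometric)
  qed
  finally show ?thesis by simp
qed

section \<open>Lcm, gcd and divisor sums through prime exponents\<close>

lemma multiplicity_Lcm_nat:
  fixes A :: "nat set"
  assumes "finite A" "A \<noteq> {}" "0 \<notin> A" "prime p"
  shows "multiplicity p (Lcm A) = Max (multiplicity p ` A)"
  using assms
proof (induction A rule: finite_ne_induct)
  case (insert x A)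
  then show ?case by (simp add: multiplicity_lcm Lcm_0_iff)
qed simp

lemma multiplicity_Gcd_nat:
  fixes A :: "nat set"
  assumes "finite A" "A \<noteq> {}" "0 \<notin> A" "prime p"
  shows "multiplicity p (Gcd A) = Min (multiplicity p ` A)"
  using assms
proof (induction A rule: finite_ne_induct)
  case (insert x A)
  have "Gcd A \<noteq> 0" using insert by (auto simp: Gcd_0_iff)
  with insert show ?case by (simp add: multiplicity_gcd)
qed simp

text \<open>Both sides are compared prime by prime: the lcm takes the maximum of the exponents, the
  gcd the minimum, and division subtracts because the gcd divides the lcm through any
  component.\<close>

lemma Lcm_div_Gcd_eq_prod:
  fixes n :: "'i \<Rightarrow> nat"
  assumes "finite I" "I \<noteq> {}" "\<And>i. i \<in> I \<Longrightarrow> n i > 0"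
  shows "Lcm (n ` I) div Gcd (n ` I) =
    (\<Prod>p\<in>tuple_primes I n. p ^ (Max (exps I n p ` I) - Min (exps I n p ` I)))"
    (is "?l = prod ?q _")
proof (rule multiplicity_eq_nat)
  define L G where "L = Lcm (n ` I)" and "G = Gcd (n ` I)"
  have "0 \<notin> n ` I" using assms by force
  then have "L \<noteq> 0" "G \<noteq> 0" using assms(1,2) by (auto simp: L_def G_def Lcm_0_iff Gcd_0_iff)
  obtain i where i: "i \<in> I" using assms(2) by auto
  have "G dvd n i" "n i dvd L" using i by (auto simp: G_def L_def)
  then have GL: "L = G * (L div G)" by (metis dvd_mult_div_cancel dvd_trans)
  then have "L div G \<noteq> 0" using \<open>L \<noteq> 0\<close> by (metis mult_is_0)
  then show "?l > 0" by (simp add: L_def G_def)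
  show "prod ?q (tuple_primes I n) > 0"
    by (rule prod_pos) (auto dest: prime_tuple_primes simp: prime_gt_0_nat)
  fix p :: nat assume p: "prime p"
  have im: "multiplicity p ` n ` I = exps I n p ` I" by (auto simp: image_image)
  have "multiplicity p L = multiplicity p G + multiplicity p (L div G)"
    using GL \<open>G \<noteq> 0\<close> \<open>L div G \<noteq> 0\<close> p prime_elem_multiplicity_mult_distrib[of p G "L div G"] by simp
  then have "multiplicity p ?l = Max (exps I n p ` I) - Min (exps I n p ` I)"
    using multiplicity_Lcm_nat[of "n ` I" p] multiplicity_Gcd_nat[of "n ` I" p] assms p \<open>0 \<notin> n ` I\<close>
    by (simp add: L_def G_def im)
  also have "\<dots> = multiplicity p (prod ?q (tuple_primes I n))"
  proof (cases "p \<in> tuple_primes I n")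
    case False
    then have "exps I n p ` I = {0}" using exps_eq_0[OF p False] assms(2) by auto
    with False show ?thesis
      using assms(1) p by (subst multiplicity_prod_prime_powers) (auto dest: prime_tuple_primes)
  qed (use assms(1) p in \<open>subst multiplicity_prod_prime_powers; auto dest: prime_tuple_primes\<close>)
  finally show "multiplicity p ?l = multiplicity p (prod ?q (tuple_primes I n))" .
qed

lemma multiplicative_function_prod_prime_powers:
  assumes "multiplicative_function f" "finite P" "\<And>p. p \<in> P \<Longrightarrow> prime p"
  shows "f (\<Prod>p\<in>P. p ^ e p) = (\<Prod>p\<in>P. f (p ^ e p))"
  using assms(2,3)
proof (induction P rule: finite_induct)
  case empty
  then show ?case using assms(1) by (simp add: multiplicative_function_def)
next
  case (insert q P)
  have "coprime (q ^ e q) (\<Prod>p\<in>P. p ^ e p)"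
    by (rule prod_coprime_right) (use insert in \<open>auto intro!: primes_coprime\<close>)
  moreover have "q ^ e q > 0" "(\<Prod>p\<in>P. p ^ e p) > 0"
    using insert by (auto intro!: prod_pos simp: prime_gt_0_nat)
  ultimately have "f (q ^ e q * (\<Prod>p\<in>P. p ^ e p)) = f (q ^ e q) * f (\<Prod>p\<in>P. p ^ e p)"
    using assms(1) by (simp add: multiplicative_function_def)
  then show ?case using insert by simp
qed

lemma multiplicative_function_Lcm_div_Gcd:
  assumes "multiplicative_function f" "finite I" "I \<noteq> {}" "\<And>i. i \<in> I \<Longrightarrow> n i > 0"
  shows "f (Lcm (n ` I) div Gcd (n ` I)) =
    euler_ext I (\<lambda>p \<nu>. f (p ^ (Max (\<nu> ` I) - Min (\<nu> ` I)))) n"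
proof -
  have "f (Lcm (n ` I) div Gcd (n ` I)) =
      f (\<Prod>p\<in>tuple_primes I n. p ^ (Max (exps I n p ` I) - Min (exps I n p ` I)))"
    by (subst Lcm_div_Gcd_eq_prod) (use assms in auto)
  also have "\<dots> = (\<Prod>p\<in>tuple_primes I n. f (p ^ (Max (exps I n p ` I) - Min (exps I n p ` I))))"
    by (rule multiplicative_function_prod_prime_powers)
      (use assms in \<open>auto dest: prime_tuple_primes\<close>)
  finally show ?thesis by (simp add: euler_ext_def)
qed

text \<open>In this form power weights can be moved into and out of local factors by
  \<open>euler_ext_mult\<close>; this happens with exponent \<open>r\<close> for the variables
  \<open>n\<close> and with \<open>-s\<close> for the divisors \<open>d\<close>.\<close>

lemma prod_powr_eq_euler_ext:
  assumes "finite I" "\<And>i. i \<in> I \<Longrightarrow> n i > 0"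
  shows "(\<Prod>i\<in>I. real (n i) powr s) = euler_ext I (\<lambda>p \<nu>. real p powr (s * real (sum \<nu> I))) n"
proof -
  have "real (n i) powr s = (\<Prod>p\<in>tuple_primes I n. real p powr (s * real (multiplicity p (n i))))"
    if i: "i \<in> I" for i
  proof -
    have sub: "prime_factors (n i) \<subseteq> tuple_primes I n" using i by (auto simp: tuple_primes_def)
    have "n i = (\<Prod>p\<in>prime_factors (n i). p ^ multiplicity p (n i))"
      using assms(2)[OF i] by (simp add: prime_factorization_nat)
    also have "\<dots> = (\<Prod>p\<in>tuple_primes I n. p ^ multiplicity p (n i))"
      by (rule prod.mono_neutral_left)
        (use sub assms(1) in \<open>auto simp: prime_factors_multiplicity dest: prime_tuple_primes\<close>)
    finally have "real (n i) = (\<Prod>p\<in>tuple_primes I n. real p ^ multiplicity p (n i))"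
      by (metis (no_types, lifting) of_nat_power of_nat_prod prod.cong)
    also have "\<dots> powr s = (\<Prod>p\<in>tuple_primes I n. (real p ^ multiplicity p (n i)) powr s)"
      by (rule prod_powr_distrib)
    also have "\<dots> = (\<Prod>p\<in>tuple_primes I n. real p powr (s * real (multiplicity p (n i))))"
    proof (rule prod.cong)
      fix p assume "p \<in> tuple_primes I n"
      then have "p > 0" by (auto dest: prime_tuple_primes simp: prime_gt_0_nat)
      then show "(real p ^ multiplicity p (n i)) powr s = real p powr (s * real (multiplicity p (n i)))"
        by (simp add: powr_powr mult.commute flip: powr_realpow)
    qed simp
    finally show ?thesis .
  qed
  then have "(\<Prod>i\<in>I. real (n i) powr s) =
      (\<Prod>i\<in>I. \<Prod>p\<in>tuple_primes I n. real p powr (s * real (multiplicity p (n i))))"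
    by simp
  also have "\<dots> = (\<Prod>p\<in>tuple_primes I n. \<Prod>i\<in>I. real p powr (s * real (multiplicity p (n i))))"
    by (rule prod.swap)
  also have "\<dots> = euler_ext I (\<lambda>p \<nu>. real p powr (s * real (sum \<nu> I))) n"
    unfolding euler_ext_def
  proof (rule prod.cong)
    fix p assume "p \<in> tuple_primes I n"
    then have "p > 0" by (auto dest: prime_tuple_primes simp: prime_gt_0_nat)
    then show "(\<Prod>i\<in>I. real p powr (s * real (multiplicity p (n i)))) =
        real p powr (s * real (sum (exps I n p) I))"
      using assms(1) by (simp add: powr_sum[symmetric] sum_distrib_left)
  qed simp
  finally show ?thesis .
qed

text \<open>The convolution identity. Divisor tuples of \<open>n\<close> are the smooth tuples whose
  exponent vectors lie in the boxes below those of \<open>n\<close>, so the divisor sum factors over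
  primes and \<open>sum_mixed_diff\<close> evaluates each factor.\<close>

lemma sum_divisors_euler_ext_mixed_diff:
  fixes h :: "nat \<Rightarrow> ('i \<Rightarrow> nat) \<Rightarrow> 'a :: {banach, real_normed_div_algebra, comm_ring_1}"
  assumes "finite I" "\<And>i. i \<in> I \<Longrightarrow> n i > 0" "\<And>p. prime p \<Longrightarrow> h p (\<lambda>i\<in>I. 0) = 1"
  shows "(\<Sum>d\<in>PiE I (\<lambda>i. {d. d dvd n i}). euler_ext I (\<lambda>p. mixed_diff I (h p)) d) = euler_ext I h n"
proof -
  define P where "P = tuple_primes I n"
  define B where "B p = PiE I (\<lambda>i. {..exps I n p i})" for p
  have "smooth_tuples I P B = PiE I (\<lambda>i. {d. d dvd n i})"
  proof (intro equalityI subsetI)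
    fix d assume d: "d \<in> smooth_tuples I P B"
    have "d i dvd n i" if i: "i \<in> I" for i
    proof (rule multiplicity_le_imp_dvd)
      show "d i \<noteq> 0" using d i by (force simp: smooth_tuples_def)
      fix p :: nat assume p: "prime p"
      show "multiplicity p (d i) \<le> multiplicity p (n i)"
      proof (cases "p \<in> P")
        case True
        then have "exps I d p \<in> B p" using d by (auto simp: smooth_tuples_def)
        then show ?thesis using i by (auto simp: B_def PiE_iff)
      next
        case False
        then have "p \<notin> prime_factors (d i)" using d i by (auto simp: smooth_tuples_def tuple_primes_def)
        then show ?thesis using p by (simp add: prime_factors_multiplicity)
      qed
    qed
    then show "d \<in> PiE I (\<lambda>i. {d. d dvd n i})" using d by (auto simp: smooth_tuples_def PiE_iff)
  next
    fix d assume d: "d \<in> PiE I (\<lambda>i. {d. d dvd n i})"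
    then have dvd: "d i dvd n i" "d i > 0" if "i \<in> I" for i
      using assms(2)[OF that] that by (auto simp: PiE_iff intro: dvd_pos_nat)
    have "tuple_primes I d \<subseteq> P"
      using dvd assms(2) unfolding P_def tuple_primes_def by (intro UN_mono dvd_prime_factors) auto
    moreover have "exps I d p \<in> B p" for p
      using dvd assms(2) by (auto simp: B_def exps_def intro!: dvd_imp_multiplicity_le)
    ultimately show "d \<in> smooth_tuples I P B"
      using d dvd by (auto simp: smooth_tuples_def PiE_iff)
  qed
  moreover have "sum (euler_ext I (\<lambda>p. mixed_diff I (h p))) (smooth_tuples I P B) =
      (\<Prod>p\<in>P. sum (mixed_diff I (h p)) (B p))"
    by (rule sum_euler_ext)
      (use assms in \<open>auto simp: P_def B_def PiE_iff intro!: finite_PiE dest: prime_tuple_primes\<close>)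
  ultimately have "(\<Sum>d\<in>PiE I (\<lambda>i. {d. d dvd n i}). euler_ext I (\<lambda>p. mixed_diff I (h p)) d) =
      (\<Prod>p\<in>P. sum (mixed_diff I (h p)) (B p))"
    by simp
  also have "\<dots> = euler_ext I h n"
    unfolding euler_ext_def P_def B_def
    by (intro prod.cong sum_mixed_diff assms exps_in refl)
  finally show ?thesis .
qed

section \<open>Sums of powers over multiples\<close>

lemma powr_succ_diff_bounds:
  fixes a b r :: real
  assumes "r \<ge> 0" "0 \<le> a" "a \<le> b"
  shows "(r + 1) * a powr r * (b - a) \<le> b powr (r + 1) - a powr (r + 1)"
    and "b powr (r + 1) - a powr (r + 1) \<le> (r + 1) * b powr r * (b - a)"
proof -
  have "(r + 1) * a powr r * (b - a) \<le> b powr (r + 1) - a powr (r + 1) \<and>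
      b powr (r + 1) - a powr (r + 1) \<le> (r + 1) * b powr r * (b - a)"
  \<comment> \<open>The mean value theorem needs a nondegenerate interval, and the derivative of the
    real power is used only at positive points; both exceptional cases are elementary.\<close>
  proof (cases "a = 0 \<or> a = b")
    case True
    then show ?thesis
    proof
      assume "a = 0"
      have "b powr (r + 1) = b powr r * b" using assms by (simp add: powr_add)
      moreover have "b powr r * b \<le> (r + 1) * (b powr r * b)"
        using assms \<open>a = 0\<close> by (simp add: distrib_right)
      ultimately show ?thesis using \<open>a = 0\<close> assms by (simp add: mult.assoc)
    qed simp
  next
    case False
    then have "0 < a" "a < b" using assms by auto
    have "((\<lambda>x. x powr (r + 1)) has_real_derivative (r + 1) * x powr r) (at x)" if "x \<ge> a" for x
      using \<open>0 < a\<close> that by (auto intro!: derivative_eq_intros)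
    then obtain z where z: "a < z" "z < b"
      "b powr (r + 1) - a powr (r + 1) = (b - a) * ((r + 1) * z powr r)"
      using MVT2[OF \<open>a < b\<close>, of "\<lambda>x. x powr (r + 1)" "\<lambda>x. (r + 1) * x powr r"] by auto
    have "a powr r \<le> z powr r" "z powr r \<le> b powr r"
      using z assms \<open>0 < a\<close> by (auto intro!: powr_mono2)
    then have "(b - a) * ((r + 1) * a powr r) \<le> (b - a) * ((r + 1) * z powr r)"
      "(b - a) * ((r + 1) * z powr r) \<le> (b - a) * ((r + 1) * b powr r)"
      using assms by (auto intro!: mult_left_mono)
    then show ?thesis unfolding z(3) by (simp add: mult_ac)
  qed
  then show "(r + 1) * a powr r * (b - a) \<le> b powr (r + 1) - a powr (r + 1)"
    "b powr (r + 1) - a powr (r + 1) \<le> (r + 1) * b powr r * (b - a)" by auto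
qed

text \<open>Induction compares each new term with the increment of
  \<open>x powr (r + 1) / (r + 1)\<close>. For the upper bound the old boundary term
  \<open>real N powr r\<close> is absorbed by the increment, and the new term becomes the boundary
  term.\<close>

lemma sum_powr_nat_bounds:
  fixes r :: real and N :: nat
  assumes "r \<ge> 0"
  shows "real N powr (r + 1) / (r + 1) \<le> (\<Sum>n=1..N. real n powr r) \<and>
    (\<Sum>n=1..N. real n powr r) \<le> real N powr (r + 1) / (r + 1) + real N powr r"
proof (induction N)
  case (Suc N)
  have "(r + 1) * real N powr r \<le> real (Suc N) powr (r + 1) - real N powr (r + 1)"
    "real (Suc N) powr (r + 1) - real N powr (r + 1) \<le> (r + 1) * real (Suc N) powr r"
    using powr_succ_diff_bounds[of r "real N" "real (Suc N)"] assms by simp_all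
  then have "real N powr r \<le> real (Suc N) powr (r + 1) / (r + 1) - real N powr (r + 1) / (r + 1)"
    "real (Suc N) powr (r + 1) / (r + 1) - real N powr (r + 1) / (r + 1) \<le> real (Suc N) powr r"
    using assms unfolding diff_divide_distrib[symmetric]
    by (simp_all add: pos_le_divide_eq pos_divide_le_eq mult.commute del: of_nat_Suc)
  then show ?case using Suc.IH by (simp del: of_nat_Suc)
qed simp

lemma sum_powr_bound:
  fixes r y :: real
  assumes "r \<ge> 0" "y \<ge> 1"
  shows "\<bar>(\<Sum>n | 1 \<le> n \<and> real n \<le> y. real n powr r) - y powr (r + 1) / (r + 1)\<bar> \<le> y powr r"
proof -
  define N where "N = nat \<lfloor>y\<rfloor>"
  have N: "real N \<le> y" "y \<le> real N + 1" using assms(2) by (auto simp: N_def)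
  have "{n. 1 \<le> n \<and> real n \<le> y} = {1..N}"
    using assms(2) by (auto simp: N_def le_nat_floor) linarith+
  then have S: "(\<Sum>n | 1 \<le> n \<and> real n \<le> y. real n powr r) = (\<Sum>n=1..N. real n powr r)" by simp
  have "y powr (r + 1) - real N powr (r + 1) \<le> (r + 1) * y powr r * (y - real N)"
    using powr_succ_diff_bounds[of r "real N" y] assms N by simp
  also have "\<dots> \<le> (r + 1) * y powr r * 1"
    using assms N by (intro mult_left_mono) auto
  finally have "y powr (r + 1) / (r + 1) - real N powr (r + 1) / (r + 1) \<le> y powr r"
    using assms unfolding diff_divide_distrib[symmetric]
    by (simp add: pos_divide_le_eq mult.commute)
  moreover have "real N powr (r + 1) / (r + 1) \<le> y powr (r + 1) / (r + 1)" "real N powr r \<le> y powr r"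
    using assms N by (auto intro!: divide_right_mono powr_mono2)
  ultimately show ?thesis unfolding S using sum_powr_nat_bounds[OF assms(1), of N] by linarith
qed

definition multiples_sum :: "real \<Rightarrow> real \<Rightarrow> nat \<Rightarrow> real" where
  "multiples_sum r x d = (\<Sum>n | 1 \<le> n \<and> real n \<le> x \<and> d dvd n. real n powr r)"

lemma multiples_sum_nonneg: "multiples_sum r x d \<ge> 0"
  by (simp add: multiples_sum_def sum_nonneg)

lemma multiples_sum_eq_0: "real d > x \<Longrightarrow> multiples_sum r x d = 0"
proof -
  assume "real d > x"
  have "\<not> (1 \<le> n \<and> real n \<le> x \<and> d dvd n)" for n
  proof
    assume n: "1 \<le> n \<and> real n \<le> x \<and> d dvd n"
    then have "d \<le> n" by (intro dvd_imp_le) auto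
    then show False using n \<open>real d > x\<close> by linarith
  qed
  then have "{n. 1 \<le> n \<and> real n \<le> x \<and> d dvd n} = {}" by blast
  then show ?thesis unfolding multiples_sum_def by (simp only: sum.empty)
qed

text \<open>Substituting \<open>n = d * m\<close> reduces to the sum up to \<open>x / d\<close>. The
  factor \<open>d powr r\<close> cancels against the error \<open>(x / d) powr r\<close>, so the
  bound does not depend on \<open>d\<close>.\<close>

lemma multiples_sum_bound:
  assumes "r \<ge> 0" "d > 0" "real d \<le> x"
  shows "\<bar>multiples_sum r x d - x powr (r + 1) / ((r + 1) * real d)\<bar> \<le> x powr r"
proof -
  have "x > 0" using assms by linarith
  have "multiples_sum r x d = (\<Sum>m | 1 \<le> m \<and> real m \<le> x / real d. real (d * m) powr r)"
    unfolding multiples_sum_def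
    by (rule sum.reindex_bij_witness[where j = "\<lambda>n. n div d" and i = "\<lambda>m. d * m"])
      (use assms(2) in \<open>auto simp: field_simps\<close>)
  also have "\<dots> = real d powr r * (\<Sum>m | 1 \<le> m \<and> real m \<le> x / real d. real m powr r)"
    by (simp add: powr_mult sum_distrib_left)
  finally have eq: "multiples_sum r x d = \<dots>" .
  have cancel: "real d powr r * (x / real d) powr r = x powr r"
    using assms \<open>x > 0\<close> by (simp add: powr_divide)
  have "real d powr r * ((x / real d) powr (r + 1) / (r + 1)) =
      (real d powr r * (x / real d) powr r) * (x / real d) / (r + 1)"
    using assms \<open>x > 0\<close> by (simp add: powr_add)
  also have "\<dots> = x powr (r + 1) / ((r + 1) * real d)"
    unfolding cancel using \<open>x > 0\<close> by (simp add: powr_add mult.commute)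
  finally have "x powr (r + 1) / ((r + 1) * real d) = real d powr r * ((x / real d) powr (r + 1) / (r + 1))"
    by simp
  then have "\<bar>multiples_sum r x d - x powr (r + 1) / ((r + 1) * real d)\<bar> =
      real d powr r * \<bar>(\<Sum>m | 1 \<le> m \<and> real m \<le> x / real d. real m powr r) -
        (x / real d) powr (r + 1) / (r + 1)\<bar>"
    unfolding eq by (simp only: right_diff_distrib[symmetric] abs_mult) simp
  also have "\<dots> \<le> real d powr r * (x / real d) powr r"
    using sum_powr_bound[OF assms(1), of "x / real d"] assms by (intro mult_left_mono) auto
  also have "\<dots> = x powr r" by (rule cancel)
  finally show ?thesis .
qed

context
  fixes r x \<delta> :: real and d :: nat
  assumes r: "r \<ge> 0" and x: "x \<ge> 1" and \<delta>: "0 < \<delta>" "\<delta> \<le> 1" and d: "d > 0"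
begin

text \<open>For \<open>d\<close> up to \<open>x\<close> the error \<open>x powr r\<close> is
  enlarged by \<open>(x / d) powr \<delta>\<close>, which is at least 1. For larger \<open>d\<close>
  the sum is empty and the main term alone is the error. The bound holds for every positive
  \<open>d\<close>, so the later sum over \<open>d\<close> can be infinite.\<close>

lemma multiples_sum_error:
  "\<bar>multiples_sum r x d - x powr (r + 1) / ((r + 1) * real d)\<bar> \<le> x powr (r + \<delta>) * real d powr (-\<delta>)"
proof (cases "real d \<le> x")
  case True
  have "\<bar>multiples_sum r x d - x powr (r + 1) / ((r + 1) * real d)\<bar> \<le> x powr r"
    using multiples_sum_bound[OF r d True] .
  also have "\<dots> \<le> x powr r * (x / real d) powr \<delta>"
    using True d \<delta> by (simp add: ge_one_powr_ge_zero)
  also have "\<dots> = x powr (r + \<delta>) * real d powr (-\<delta>)"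
    using x d by (simp add: powr_divide powr_add powr_minus field_simps)
  finally show ?thesis .
next
  case False
  have "\<bar>multiples_sum r x d - x powr (r + 1) / ((r + 1) * real d)\<bar> = x powr (r + 1) / ((r + 1) * real d)"
    using False r d by (simp add: multiples_sum_eq_0)
  also have "\<dots> \<le> x powr (r + 1) / (1 * real d)"
    using r d by (intro divide_left_mono mult_right_mono) auto
  also have "\<dots> = x powr (r + \<delta>) * (x powr (1 - \<delta>) / real d)"
    by (simp flip: powr_add)
  also have "\<dots> \<le> x powr (r + \<delta>) * (real d powr (1 - \<delta>) / real d)"
    using False x \<delta> by (intro mult_left_mono divide_right_mono powr_mono2) auto
  also have "real d powr (1 - \<delta>) / real d = real d powr (-\<delta>)"
    using d by (simp add: powr_diff powr_minus field_simps)
  finally show ?thesis .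
qed

lemma inverse_le_powr: "1 / real d \<le> real d powr (-\<delta>)"
proof -
  have "real d powr (-1) \<le> real d powr (-\<delta>)" using d \<delta> by (intro powr_mono) auto
  then show ?thesis using d by (simp add: powr_minus_divide)
qed

text \<open>The factor 2 matches \<open>multiples_sum_le\<close>, so that one majorant serves for
  the sum and for its main term.\<close>

lemma main_term_le: "x powr (r + 1) / ((r + 1) * real d) \<le> 2 * x powr (r + 1) * real d powr (-\<delta>)"
proof -
  have "x powr (r + 1) / ((r + 1) * real d) \<le> x powr (r + 1) / (1 * real d)"
    using r d by (intro divide_left_mono mult_right_mono) auto
  also have "\<dots> \<le> x powr (r + 1) * real d powr (-\<delta>)"
    using mult_left_mono[OF inverse_le_powr, of "x powr (r + 1)"] by simp
  also have "\<dots> \<le> 2 * x powr (r + 1) * real d powr (-\<delta>)" by simp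
  finally show ?thesis .
qed

lemma multiples_sum_le: "multiples_sum r x d \<le> 2 * x powr (r + 1) * real d powr (-\<delta>)"
proof (cases "real d \<le> x")
  case True
  have "multiples_sum r x d \<le> x powr (r + 1) / ((r + 1) * real d) + x powr r"
    using multiples_sum_bound[OF r d True] by linarith
  also have "x powr (r + 1) / ((r + 1) * real d) \<le> x powr (r + 1) / (1 * real d)"
    using r d by (intro divide_left_mono mult_right_mono) auto
  also have "x powr r \<le> x powr r * (x / real d)"
    using True d mult_left_mono[of 1 "x / real d" "x powr r"] by simp
  also have "x powr r * (x / real d) = x powr (r + 1) / real d"
    using x by (simp add: powr_add)
  also have "x powr (r + 1) / (1 * real d) + x powr (r + 1) / real d = 2 * x powr (r + 1) * (1 / real d)"
    by simp
  also have "\<dots> \<le> 2 * x powr (r + 1) * real d powr (-\<delta>)"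
    by (intro mult_left_mono inverse_le_powr) auto
  finally show ?thesis by simp
qed (simp add: multiples_sum_eq_0)

end

text \<open>After division by the common majorants \<open>Q i\<close> all factors have absolute
  value at most 1, so the difference of the products is at most the sum of the differences of the
  factors. Each of these saves \<open>x powr (\<delta> - 1)\<close>.\<close>

lemma prod_multiples_sum_error:
  fixes d :: "'i \<Rightarrow> nat"
  assumes "r \<ge> 0" "x \<ge> 1" "0 < \<delta>" "\<delta> \<le> 1" "\<And>i. i \<in> I \<Longrightarrow> d i > 0"
  shows "\<bar>(\<Prod>i\<in>I. multiples_sum r x (d i)) - (\<Prod>i\<in>I. x powr (r + 1) / ((r + 1) * real (d i)))\<bar> \<le>
    real (card I) * 2 ^ card I * x powr (real (card I) * (r + 1) + \<delta> - 1) * (\<Prod>i\<in>I. real (d i) powr (-\<delta>))"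
proof -
  define M where "M i = x powr (r + 1) / ((r + 1) * real (d i))" for i
  define T where "T i = multiples_sum r x (d i)" for i
  define Q where "Q i = 2 * x powr (r + 1) * real (d i) powr (-\<delta>)" for i
  have Q: "Q i > 0" if "i \<in> I" for i using assms(2) assms(5)[OF that] by (auto simp: Q_def)
  have prodQ: "(\<Prod>i\<in>I. Q i) =
      2 ^ card I * x powr (real (card I) * (r + 1)) * (\<Prod>i\<in>I. real (d i) powr (-\<delta>))"
    using assms(2) by (simp add: Q_def prod.distrib powr_powr[symmetric] powr_realpow[symmetric] mult.commute)
  have "norm ((\<Prod>i\<in>I. T i / Q i) - (\<Prod>i\<in>I. M i / Q i)) \<le> (\<Sum>i\<in>I. norm (T i / Q i - M i / Q i))"
  proof (rule norm_prod_diff)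
    fix i assume i: "i \<in> I"
    note * = assms(1-4) assms(5)[OF i]
    show "norm (T i / Q i) \<le> 1"
      using multiples_sum_le[OF *] Q[OF i] multiples_sum_nonneg[of r x "d i"]
      by (simp add: T_def Q_def[symmetric])
    have "0 \<le> M i" "M i \<le> Q i"
      unfolding M_def Q_def using main_term_le[OF *] * by (auto intro!: divide_nonneg_nonneg)
    then show "norm (M i / Q i) \<le> 1" using Q[OF i] by simp
  qed
  also have "\<dots> \<le> (\<Sum>i\<in>I. x powr (\<delta> - 1))"
  proof (rule sum_mono)
    fix i assume i: "i \<in> I"
    note * = assms(1-4) assms(5)[OF i]
    have "norm (T i / Q i - M i / Q i) = \<bar>T i - M i\<bar> / Q i"
      using Q[OF i] by (simp add: diff_divide_distrib[symmetric])
    also have "\<dots> \<le> (x powr (r + \<delta>) * real (d i) powr (-\<delta>)) / Q i"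
      using multiples_sum_error[OF *] Q[OF i] by (intro divide_right_mono) (auto simp: T_def M_def)
    also have "\<dots> = x powr (r + \<delta>) / x powr (r + 1) / 2"
      using assms(5)[OF i] by (simp add: Q_def)
    also have "\<dots> = x powr (\<delta> - 1) / 2" by (simp flip: powr_diff)
    also have "\<dots> \<le> x powr (\<delta> - 1)" by simp
    finally show "norm (T i / Q i - M i / Q i) \<le> x powr (\<delta> - 1)" .
  qed
  finally have *: "\<bar>(\<Prod>i\<in>I. T i / Q i) - (\<Prod>i\<in>I. M i / Q i)\<bar> \<le> real (card I) * x powr (\<delta> - 1)"
    by simp
  have "\<bar>prod T I - prod M I\<bar> = prod Q I * \<bar>(\<Prod>i\<in>I. T i / Q i) - (\<Prod>i\<in>I. M i / Q i)\<bar>"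
  proof -
    have "prod Q I > 0" using Q by (rule prod_pos)
    then show ?thesis
      by (simp add: prod_dividef diff_divide_distrib[symmetric] abs_divide)
  qed
  also have "\<dots> \<le> prod Q I * (real (card I) * x powr (\<delta> - 1))"
    using Q by (intro mult_left_mono * prod_nonneg) (auto intro: less_imp_le)
  also have "\<dots> = real (card I) * 2 ^ card I * x powr (real (card I) * (r + 1) + \<delta> - 1) *
      (\<Prod>i\<in>I. real (d i) powr (-\<delta>))"
    unfolding prodQ by (simp add: add_diff_eq[symmetric] powr_add)
  finally show ?thesis by (simp add: T_def M_def)
qed

section \<open>Local factors and the asymptotic formula\<close>

definition normalized_local ::
  "(nat \<Rightarrow> complex) \<Rightarrow> real \<Rightarrow> 'i set \<Rightarrow> nat \<Rightarrow> ('i \<Rightarrow> nat) \<Rightarrow> complex" where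
  "normalized_local f r I p \<nu> =
     f (p ^ (Max (\<nu> ` I) - Min (\<nu> ` I))) / of_real (real p powr (r * real (sum \<nu> I)))"

text \<open>The local factor of \<open>G(d)\<close> times the product of the
  \<open>d i powr (-s)\<close>. The value \<open>s = 1\<close> gives the main term, and values
  slightly above 1/2 give the error term.\<close>

definition local_coeff ::
  "(nat \<Rightarrow> complex) \<Rightarrow> real \<Rightarrow> 'i set \<Rightarrow> real \<Rightarrow> nat \<Rightarrow> ('i \<Rightarrow> nat) \<Rightarrow> complex" where
  "local_coeff f r I s p \<nu> =
     mixed_diff I (normalized_local f r I p) \<nu> * of_real (real p powr (-s * real (sum \<nu> I)))"

definition tuple_coeff :: "(nat \<Rightarrow> complex) \<Rightarrow> real \<Rightarrow> 'i set \<Rightarrow> ('i \<Rightarrow> nat) \<Rightarrow> complex" where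
  "tuple_coeff f r I = euler_ext I (\<lambda>p. mixed_diff I (normalized_local f r I p))"

lemma of_real_euler_ext:
  "of_real (euler_ext I a d) = euler_ext I (\<lambda>p \<nu>. of_real (a p \<nu>) :: 'a :: {real_algebra_1, comm_ring_1}) d"
  by (simp add: euler_ext_def)

text \<open>One constant \<open>C\<close> replaces both constants of the class, and the prime power
  bound is extended to the exponents 0 and 1, so that it bounds all local values at once.\<close>

locale class_A_function =
  fixes f :: "nat \<Rightarrow> complex" and r C :: real and I :: "'i set"
  assumes finite_I: "finite I" and card_I: "card I \<ge> 2"
    and r_nonneg: "r \<ge> 0" and C_ge_1: "C \<ge> 1"
    and mult_f: "multiplicative_function f"
    and f_prime: "\<And>p. prime p \<Longrightarrow> norm (f p - of_real (real p powr r)) \<le> C * real p powr (r - 1/2)"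
    and f_prime_power: "\<And>p m. prime p \<Longrightarrow> norm (f (p ^ m)) \<le> C * real p powr (r * real m)"
begin

lemma I_nonempty: "I \<noteq> {}" using card_I by auto

lemma f_1 [simp]: "f (Suc 0) = 1"
  using mult_f by (simp add: multiplicative_function_def)

lemma normalized_local_0: "prime p \<Longrightarrow> normalized_local f r I p (\<lambda>i\<in>I. 0) = 1"
  using I_nonempty prime_gt_0_nat[of p] by (simp add: normalized_local_def image_constant_conv)

lemma norm_normalized_local_le:
  assumes "prime p"
  shows "norm (normalized_local f r I p \<nu>) \<le> C"
proof -
  have p: "real p \<ge> 1" using prime_ge_1_nat[OF assms] by simp
  \<comment> \<open>The exponent max minus min is at most the weight of \<open>\<nu>\<close>; since
    \<open>r\<close> is nonnegative, the normalisation then compensates the growth of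
    \<open>f\<close>.\<close>
  have "Max (\<nu> ` I) \<le> sum \<nu> I"
    using finite_I I_nonempty by (auto intro: member_le_sum)
  then have le: "real (Max (\<nu> ` I) - Min (\<nu> ` I)) \<le> real (sum \<nu> I)" by linarith
  have "norm (f (p ^ (Max (\<nu> ` I) - Min (\<nu> ` I)))) \<le>
      C * real p powr (r * real (Max (\<nu> ` I) - Min (\<nu> ` I)))"
    by (rule f_prime_power[OF assms])
  also have "\<dots> \<le> C * real p powr (r * real (sum \<nu> I))"
    using p C_ge_1 r_nonneg le by (intro mult_left_mono powr_mono) auto
  finally show ?thesis
    using p by (simp add: normalized_local_def norm_divide pos_divide_le_eq)
qed

text \<open>
  With at least two variables a unit vector has maximum 1 and minimum 0, so (i) applies to \<open>f(p)\<close>.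
\<close>

lemma norm_mixed_diff_sum_eq_1:
  assumes "prime p" "\<nu> \<in> I \<rightarrow>\<^sub>E UNIV" "sum \<nu> I = 1"
  shows "norm (mixed_diff I (normalized_local f r I p) \<nu>) \<le> C * real p powr (-1/2)"
proof -
  have p: "real p > 0" using prime_gt_0_nat[OF assms(1)] by simp
  obtain j where j: "j \<in> I" "\<nu> j = 1" "\<And>i. i \<in> I \<Longrightarrow> i \<noteq> j \<Longrightarrow> \<nu> i = 0"
    using assms(3) finite_I by (auto simp: sum_eq_Suc0_iff)
  have "card (I - {j}) > 0" using card_I finite_I j(1) by simp
  then obtain i where i: "i \<in> I" "i \<noteq> j" by (auto simp: card_gt_0_iff)
  have "\<nu> ` I = {0, 1}" using i j by (force simp: image_iff)
  then have "normalized_local f r I p \<nu> = f p / of_real (real p powr r)"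
    using assms(3) by (simp add: normalized_local_def)
  then have "mixed_diff I (normalized_local f r I p) \<nu> = (f p - of_real (real p powr r)) / of_real (real p powr r)"
    using p assms finite_I by (simp add: mixed_diff_sum_eq_1 normalized_local_0 diff_divide_distrib)
  also have "norm \<dots> \<le> C * real p powr (r - 1/2) / real p powr r"
    using f_prime[OF assms(1)] p by (simp add: norm_divide divide_right_mono)
  also have "\<dots> = C * (real p powr (r - 1/2) / real p powr r)" by simp
  also have "real p powr (r - 1/2) / real p powr r = real p powr (-1/2)" by (simp flip: powr_diff)
  finally show ?thesis .
qed

section \<open>Bounds and convergence of the local factors\<close>

lemma local_coeff_0: "prime p \<Longrightarrow> local_coeff f r I s p (\<lambda>i\<in>I. 0) = 1"
  using prime_gt_0_nat[of p] by (simp add: local_coeff_def normalized_local_0)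

text \<open>The largest value of \<open>p powr (-s)\<close> over the primes, for positive
  \<open>s\<close>: a geometric ratio uniform in \<open>p\<close>.\<close>

definition geom :: "real \<Rightarrow> real" where
  "geom s = 2 powr (-s)"

definition local_const :: "real \<Rightarrow> real" where
  "local_const s = 2 ^ card I * C / (geom s)\<^sup>2"

text \<open>At weight 1 the mixed difference supplies \<open>p powr (-1/2)\<close> and the weight
  factor \<open>p powr (-s)\<close>. At weight at least 2 two of the factors
  \<open>p powr (-s)\<close> already suffice, because \<open>s\<close> is at least 1/2; the others
  are bounded by \<open>geom s\<close>. Splitting off two factors explains the square in
  \<open>local_const\<close>.\<close>

lemma norm_local_coeff_le:
  assumes "prime p" "\<nu> \<in> I \<rightarrow>\<^sub>E UNIV" "\<nu> \<noteq> (\<lambda>i\<in>I. 0)" "s \<ge> 1/2"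
  shows "norm (local_coeff f r I s p \<nu>) \<le> local_const s * real p powr (-1/2 - s) * geom s ^ sum \<nu> I"
proof -
  define q u v m where "q = real p powr (-s)" and "u = geom s" and "v = real p powr (-1/2)"
    and "m = sum \<nu> I"
  have p: "real p \<ge> 2" using prime_ge_2_nat[OF assms(1)] by simp
  have "m \<noteq> 0"
  proof
    assume "m = 0"
    then have "\<nu> = (\<lambda>i\<in>I. 0)"
      using assms(2) finite_I by (auto simp: m_def fun_eq_iff PiE_iff extensional_def)
    then show False using assms(3) by simp
  qed
  have pos: "q > 0" "u > 0" "v > 0" using p by (auto simp: q_def u_def v_def geom_def)
  have qu: "q \<le> u" unfolding q_def u_def geom_def using p assms(4) by (intro powr_mono2') auto
  have u1: "u \<le> 1" unfolding u_def geom_def using assms(4) powr_mono[of "-s" 0 "2::real"] by simp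
  have qv: "q \<le> v" unfolding q_def v_def using p assms(4) by (intro powr_mono) auto
  have vq: "real p powr (-1/2 - s) = v * q" by (simp add: v_def q_def flip: powr_add)
  have norm_eq: "norm (local_coeff f r I s p \<nu>) =
      norm (mixed_diff I (normalized_local f r I p) \<nu>) * q ^ m"
  proof -
    have "real p powr (-s * real m) = q ^ m"
      using p pos by (simp add: q_def powr_powr flip: powr_realpow)
    then show ?thesis using pos
      unfolding local_coeff_def norm_mult norm_of_real m_def[symmetric] by simp
  qed
  have K: "local_const s * real p powr (-1/2 - s) * geom s ^ sum \<nu> I =
      2 ^ card I * C * (u ^ m / u\<^sup>2) * (v * q)"
    unfolding vq by (simp add: local_const_def u_def m_def)
  show ?thesis
  proof (cases "m = 1")
    case True
    have "norm (mixed_diff I (normalized_local f r I p) \<nu>) * q ^ m \<le> C * v * q"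
      using norm_mixed_diff_sum_eq_1[OF assms(1,2)] True pos
      by (simp add: m_def v_def mult_right_mono)
    also have "\<dots> = 1 * C * 1 * (v * q)" by simp
    also have "\<dots> \<le> 2 ^ card I * C * (u ^ m / u\<^sup>2) * (v * q)"
      using pos u1 C_ge_1 True by (intro mult_mono) (auto simp: power2_eq_square)
    finally show ?thesis unfolding norm_eq K .
  next
    case False
    then have "m = (m - 2) + 2" using \<open>m \<noteq> 0\<close> by simp
    then obtain l where l: "m = l + 2" by blast
    have "norm (mixed_diff I (normalized_local f r I p) \<nu>) * q ^ m \<le> 2 ^ card I * C * q ^ m"
      using norm_mixed_diff_le[OF finite_I norm_normalized_local_le[OF assms(1)]] pos
      by (intro mult_right_mono) auto
    also have "\<dots> = 2 ^ card I * C * (q ^ l * (q * q))" by (simp add: l power_add power2_eq_square)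
    also have "\<dots> \<le> 2 ^ card I * C * (u ^ l * (v * q))"
      using pos qu qv C_ge_1 by (intro mult_left_mono mult_mono power_mono) auto
    also have "\<dots> = 2 ^ card I * C * (u ^ m / u\<^sup>2) * (v * q)"
      using pos by (simp add: l power_add power2_eq_square)
    finally show ?thesis unfolding norm_eq K .
  qed
qed

definition tail_const :: "real \<Rightarrow> real" where
  "tail_const s = local_const s * (1 / (1 - geom s)) ^ card I"

lemma geom_bounds: "s > 0 \<Longrightarrow> 0 < geom s" "s > 0 \<Longrightarrow> geom s < 1"
  using powr_less_mono[of "-s" 0 "2::real"] by (auto simp: geom_def)

lemma local_const_nonneg: "local_const s \<ge> 0"
  using C_ge_1 by (simp add: local_const_def)

lemma tail_const_nonneg: "s > 0 \<Longrightarrow> tail_const s \<ge> 0"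
  using local_const_nonneg[of s] geom_bounds[of s] by (simp add: tail_const_def)

lemma sum_norm_local_coeff_tail_le:
  assumes "prime p" "finite B" "B \<subseteq> (I \<rightarrow>\<^sub>E UNIV) - {\<lambda>i\<in>I. 0}" "s \<ge> 1/2"
  shows "(\<Sum>\<nu>\<in>B. norm (local_coeff f r I s p \<nu>)) \<le> tail_const s * real p powr (-1/2 - s)"
proof -
  have "(\<Sum>\<nu>\<in>B. norm (local_coeff f r I s p \<nu>)) \<le>
      (\<Sum>\<nu>\<in>B. local_const s * real p powr (-1/2 - s) * geom s ^ sum \<nu> I)"
    using assms by (intro sum_mono norm_local_coeff_le) auto
  also have "\<dots> = local_const s * real p powr (-1/2 - s) * (\<Sum>\<nu>\<in>B. geom s ^ sum \<nu> I)"
    by (simp add: sum_distrib_left)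
  also have "\<dots> \<le> local_const s * real p powr (-1/2 - s) * (1 / (1 - geom s)) ^ card I"
    using assms local_const_nonneg[of s] geom_bounds[of s] finite_I
    by (intro mult_left_mono sum_power_sum_le) auto
  finally show ?thesis by (simp add: tail_const_def mult_ac)
qed

lemma sum_norm_local_coeff_le:
  assumes "prime p" "finite B" "B \<subseteq> I \<rightarrow>\<^sub>E UNIV" "s \<ge> 1/2"
  shows "(\<Sum>\<nu>\<in>B. norm (local_coeff f r I s p \<nu>)) \<le> 1 + tail_const s * real p powr (-1/2 - s)"
proof -
  define z where "z = (\<lambda>i\<in>I. 0 :: nat)"
  \<comment> \<open>The zero vector, with coefficient 1, is added whether or not it lies in
    \<open>B\<close>; the tail bound covers only the other vectors.\<close>
  have "(\<Sum>\<nu>\<in>B. norm (local_coeff f r I s p \<nu>)) \<le> (\<Sum>\<nu>\<in>insert z (B - {z}). norm (local_coeff f r I s p \<nu>))"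
    using assms(2) by (intro sum_mono2) auto
  also have "\<dots> = 1 + (\<Sum>\<nu>\<in>B - {z}. norm (local_coeff f r I s p \<nu>))"
    using assms(1,2) by (subst sum.insert) (auto simp: z_def local_coeff_0)
  also have "\<dots> \<le> 1 + tail_const s * real p powr (-1/2 - s)"
    using assms by (intro add_left_mono sum_norm_local_coeff_tail_le) (auto simp: z_def)
  finally show ?thesis .
qed

lemma abs_summable_local_coeff:
  assumes "prime p" "s \<ge> 1/2"
  shows "local_coeff f r I s p abs_summable_on (I \<rightarrow>\<^sub>E UNIV)"
  unfolding abs_summable_iff_bdd_above
  using sum_norm_local_coeff_le[OF assms(1) _ _ assms(2)] by (intro bdd_aboveI2) auto

text \<open>The exponent \<open>-1/2 - s\<close> lies below -1 exactly when \<open>s > 1/2\<close>.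
  This threshold determines the exponent saved in the error term.\<close>

lemma abs_summable_tuple_coeff:
  assumes "s > 1/2"
  shows "euler_ext I (local_coeff f r I s) abs_summable_on (I \<rightarrow>\<^sub>E {0<..})"
proof (rule abs_summable_euler_ext[where b = "\<lambda>p. tail_const s * real p powr (-1/2 - s)"])
  show "summable (\<lambda>p. tail_const s * real p powr (-1/2 - s))"
    using assms by (intro summable_mult) (simp add: summable_real_powr_iff)
qed (use assms finite_I local_coeff_0 tail_const_nonneg[of s] sum_norm_local_coeff_le in auto)

lemma euler_ext_local_coeff:
  assumes "d \<in> I \<rightarrow>\<^sub>E {0<..}"
  shows "euler_ext I (local_coeff f r I s) d =
    tuple_coeff f r I d * of_real (\<Prod>i\<in>I. real (d i) powr (-s))"
proof -
  have "(\<Prod>i\<in>I. real (d i) powr (-s)) = euler_ext I (\<lambda>p \<nu>. real p powr (-s * real (sum \<nu> I))) d"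
    by (rule prod_powr_eq_euler_ext) (use assms finite_I in auto)
  then show ?thesis
    unfolding local_coeff_def tuple_coeff_def by (simp only: euler_ext_mult of_real_euler_ext)
qed

lemma local_summable:
  assumes "prime p"
  shows "(\<lambda>\<nu>. normalized_local f r I p \<nu> * of_real (1 / real p) ^ sum \<nu> I) summable_on (I \<rightarrow>\<^sub>E UNIV)"
proof (rule abs_summable_summable, unfold abs_summable_iff_bdd_above, rule bdd_aboveI2)
  fix B :: "('i \<Rightarrow> nat) set" assume "B \<in> {F. F \<subseteq> I \<rightarrow>\<^sub>E UNIV \<and> finite F}"
  then have B: "B \<subseteq> I \<rightarrow>\<^sub>E UNIV" "finite B" by auto
  have p: "real p \<ge> 2" using prime_ge_2_nat[OF assms] by simp
  have "(\<Sum>\<nu>\<in>B. norm (normalized_local f r I p \<nu> * of_real (1 / real p) ^ sum \<nu> I)) \<le>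
      (\<Sum>\<nu>\<in>B. C * (1 / real p) ^ sum \<nu> I)"
    using norm_normalized_local_le[OF assms]
    by (intro sum_mono) (simp add: norm_mult norm_power norm_divide divide_right_mono power_one_over)
  also have "\<dots> = C * (\<Sum>\<nu>\<in>B. (1 / real p) ^ sum \<nu> I)" by (simp add: sum_distrib_left)
  also have "\<dots> \<le> C * (1 / (1 - 1 / real p)) ^ card I"
    using B p C_ge_1 finite_I by (intro mult_left_mono sum_power_sum_le) auto
  finally show "(\<Sum>\<nu>\<in>B. norm (normalized_local f r I p \<nu> * of_real (1 / real p) ^ sum \<nu> I)) \<le>
    C * (1 / (1 - 1 / real p)) ^ card I" .
qed

text \<open>The case \<open>w = 1/p\<close> of \<open>has_sum_mixed_diff\<close>; it identifies the
  local sums of \<open>G\<close> with the Euler factors of the constant.\<close>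

lemma infsum_local_coeff_1:
  assumes "prime p"
  shows "infsum (local_coeff f r I 1 p) (I \<rightarrow>\<^sub>E UNIV) = of_real ((1 - 1 / real p) ^ card I) *
    (\<Sum>\<^sub>\<infinity>\<nu>\<in>I \<rightarrow>\<^sub>E UNIV. normalized_local f r I p \<nu> * of_real (1 / real p) ^ sum \<nu> I)"
proof -
  have p: "real p > 0" using prime_gt_0_nat[OF assms] by simp
  have "local_coeff f r I 1 p =
      (\<lambda>\<nu>. mixed_diff I (normalized_local f r I p) \<nu> * of_real (1 / real p) ^ sum \<nu> I)"
  proof
    fix \<nu>
    have "real p powr (-1 * real (sum \<nu> I)) = (1 / real p) ^ sum \<nu> I"
      using p by (simp add: powr_minus powr_realpow power_one_over inverse_eq_divide del: of_nat_sum)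
    then show "local_coeff f r I 1 p \<nu> =
        mixed_diff I (normalized_local f r I p) \<nu> * of_real (1 / real p) ^ sum \<nu> I"
      unfolding local_coeff_def by (simp only: of_real_power)
  qed
  moreover have "((\<lambda>\<nu>. mixed_diff I (normalized_local f r I p) \<nu> * of_real (1 / real p) ^ sum \<nu> I)
      has_sum ((1 - of_real (1 / real p)) ^ card I *
      (\<Sum>\<^sub>\<infinity>\<nu>\<in>I \<rightarrow>\<^sub>E UNIV. normalized_local f r I p \<nu> * of_real (1 / real p) ^ sum \<nu> I)))
      (I \<rightarrow>\<^sub>E UNIV)"
    by (intro has_sum_mixed_diff finite_I has_sum_infsum local_summable assms)
  ultimately show ?thesis by (simp add: infsumI)
qed

text \<open>Removing the zero vector leaves the tail. At \<open>s = 1\<close> the bound is summable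
  over \<open>p\<close>, which gives absolute convergence of the Euler product.\<close>

lemma norm_infsum_local_coeff_minus_1_le:
  assumes "prime p" "s \<ge> 1/2"
  shows "norm (infsum (local_coeff f r I s p) (I \<rightarrow>\<^sub>E UNIV) - 1) \<le> tail_const s * real p powr (-1/2 - s)"
proof -
  define z A where "z = (\<lambda>i\<in>I. 0 :: nat)" and "A = (I \<rightarrow>\<^sub>E (UNIV :: nat set)) - {z}"
  have abs: "local_coeff f r I s p abs_summable_on A"
    using abs_summable_local_coeff[OF assms] by (rule summable_on_subset) (auto simp: A_def)
  have "I \<rightarrow>\<^sub>E (UNIV :: nat set) = insert z A" by (auto simp: z_def A_def)
  then have "infsum (local_coeff f r I s p) (I \<rightarrow>\<^sub>E UNIV) = local_coeff f r I s p z + infsum (local_coeff f r I s p) A"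
    using infsum_insert[OF abs_summable_summable[OF abs], of z] by (simp add: A_def)
  then have "norm (infsum (local_coeff f r I s p) (I \<rightarrow>\<^sub>E UNIV) - 1) = norm (infsum (local_coeff f r I s p) A)"
    using local_coeff_0[OF assms(1)] by (simp add: z_def)
  also have "\<dots> \<le> infsum (\<lambda>\<nu>. norm (local_coeff f r I s p \<nu>)) A"
    by (rule norm_infsum_bound[OF abs])
  also have "\<dots> \<le> tail_const s * real p powr (-1/2 - s)"
    using abs
  proof (rule infsum_le_finite_sums)
    fix B assume "finite B" "B \<subseteq> A"
    then show "(\<Sum>\<nu>\<in>B. norm (local_coeff f r I s p \<nu>)) \<le> tail_const s * real p powr (-1/2 - s)"
      using assms by (intro sum_norm_local_coeff_tail_le) (auto simp: A_def z_def)
  qed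
  finally show ?thesis .
qed

section \<open>Interchange of summation and the error term\<close>

lemma sum_Lcm_div_Gcd:
  fixes x :: real
  shows "(\<Sum>n\<in>I \<rightarrow>\<^sub>E {m. 1 \<le> m \<and> real m \<le> x}. f (Lcm (n ` I) div Gcd (n ` I))) =
    (\<Sum>d\<in>I \<rightarrow>\<^sub>E {m. 1 \<le> m \<and> real m \<le> x}.
       tuple_coeff f r I d * of_real (\<Prod>i\<in>I. multiples_sum r x (d i)))"
proof -
  define X where "X = {m :: nat. 1 \<le> m \<and> real m \<le> x}"
  have "X \<subseteq> {..nat \<lfloor>x\<rfloor>}" by (auto simp: X_def le_nat_floor)
  then have fin: "finite X" by (rule finite_subset) simp
  have finP: "finite (I \<rightarrow>\<^sub>E X)" using fin finite_I by (simp add: finite_PiE)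
  have "(\<Sum>n\<in>I \<rightarrow>\<^sub>E X. f (Lcm (n ` I) div Gcd (n ` I))) =
      (\<Sum>n\<in>I \<rightarrow>\<^sub>E X. \<Sum>d\<in>{d \<in> I \<rightarrow>\<^sub>E X. \<forall>i\<in>I. d i dvd n i}.
         tuple_coeff f r I d * of_real (\<Prod>i\<in>I. real (n i) powr r))"
  proof (rule sum.cong)
    fix n assume n: "n \<in> I \<rightarrow>\<^sub>E X"
    then have npos: "n i > 0" if "i \<in> I" for i using that by (auto simp: X_def PiE_iff)
    have "f (Lcm (n ` I) div Gcd (n ` I)) =
        euler_ext I (\<lambda>p \<nu>. f (p ^ (Max (\<nu> ` I) - Min (\<nu> ` I)))) n"
      by (intro multiplicative_function_Lcm_div_Gcd mult_f finite_I I_nonempty npos)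
    \<comment> \<open>Only the normalised function is expanded over divisors; the powers of the
      \<open>n i\<close> stay behind as weights and later form \<open>multiples_sum\<close>.\<close>
    also have "\<dots> = euler_ext I (\<lambda>p \<nu>. normalized_local f r I p \<nu> *
        of_real (real p powr (r * real (sum \<nu> I)))) n"
      unfolding euler_ext_def
      by (intro prod.cong) (auto simp: normalized_local_def dest!: prime_tuple_primes)
    also have "\<dots> = euler_ext I (normalized_local f r I) n * of_real (\<Prod>i\<in>I. real (n i) powr r)"
      using prod_powr_eq_euler_ext[OF finite_I npos, where s = r] by (simp only: euler_ext_mult of_real_euler_ext)
    also have "euler_ext I (normalized_local f r I) n =
        (\<Sum>d\<in>PiE I (\<lambda>i. {d. d dvd n i}). tuple_coeff f r I d)"
      unfolding tuple_coeff_def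
      by (intro sum_divisors_euler_ext_mixed_diff[symmetric] finite_I npos normalized_local_0)
    \<comment> \<open>Divisors of numbers up to \<open>x\<close> are again at most \<open>x\<close>,
      so \<open>d\<close> ranges over a box independent of \<open>n\<close> and the two sums can be
      exchanged.\<close>
    also have "PiE I (\<lambda>i. {d. d dvd n i}) = {d \<in> I \<rightarrow>\<^sub>E X. \<forall>i\<in>I. d i dvd n i}"
    proof -
      have "d \<in> X" if "i \<in> I" "d dvd n i" for i d
      proof -
        have "d \<le> n i" "d > 0" using that npos by (auto intro: dvd_imp_le dvd_pos_nat)
        moreover have "real (n i) \<le> x" using n that by (auto simp: X_def PiE_iff)
        ultimately show ?thesis by (auto simp: X_def)
      qed
      then show ?thesis by (auto simp: PiE_def Pi_def)
    qed
    finally show "f (Lcm (n ` I) div Gcd (n ` I)) = (\<Sum>d\<in>{d \<in> I \<rightarrow>\<^sub>E X. \<forall>i\<in>I. d i dvd n i}.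
         tuple_coeff f r I d * of_real (\<Prod>i\<in>I. real (n i) powr r))"
      by (simp add: sum_distrib_right)
  qed simp
  also have "\<dots> = (\<Sum>d\<in>I \<rightarrow>\<^sub>E X. \<Sum>n\<in>{n \<in> I \<rightarrow>\<^sub>E X. \<forall>i\<in>I. d i dvd n i}.
         tuple_coeff f r I d * of_real (\<Prod>i\<in>I. real (n i) powr r))"
    by (rule sum.swap_restrict) (rule finP)+
  also have "\<dots> = (\<Sum>d\<in>I \<rightarrow>\<^sub>E X. tuple_coeff f r I d * of_real (\<Prod>i\<in>I. multiples_sum r x (d i)))"
  proof (rule sum.cong)
    fix d
    have "(\<Prod>i\<in>I. multiples_sum r x (d i)) = (\<Prod>i\<in>I. \<Sum>n\<in>{n \<in> X. d i dvd n}. real n powr r)"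
      by (simp add: multiples_sum_def X_def conj_assoc)
    also have "\<dots> = (\<Sum>n\<in>PiE I (\<lambda>i. {n \<in> X. d i dvd n}). \<Prod>i\<in>I. real (n i) powr r)"
      by (rule prod_sum_PiE) (use fin finite_I in auto)
    also have "PiE I (\<lambda>i. {n \<in> X. d i dvd n}) = {n \<in> I \<rightarrow>\<^sub>E X. \<forall>i\<in>I. d i dvd n i}"
      by (auto simp: PiE_def Pi_def)
    finally show "(\<Sum>n\<in>{n \<in> I \<rightarrow>\<^sub>E X. \<forall>i\<in>I. d i dvd n i}.
        tuple_coeff f r I d * of_real (\<Prod>i\<in>I. real (n i) powr r)) =
        tuple_coeff f r I d * of_real (\<Prod>i\<in>I. multiples_sum r x (d i))"
      by (simp add: sum_distrib_left)
  qed simp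
  finally show ?thesis by (simp add: X_def)
qed

text \<open>Both the sum and its main term are written as series over all positive tuples
  \<open>d\<close> and compared term by term. The error lemma with \<open>\<delta> = s\<close>
  leaves exactly the absolutely convergent series at \<open>s\<close>.\<close>

lemma sum_Lcm_div_Gcd_asymptotics:
  fixes x :: real
  assumes "x \<ge> 1" "1/2 < s" "s \<le> 1"
  shows "norm ((\<Sum>n\<in>I \<rightarrow>\<^sub>E {m. 1 \<le> m \<and> real m \<le> x}. f (Lcm (n ` I) div Gcd (n ` I))) -
      infsum (euler_ext I (local_coeff f r I 1)) (I \<rightarrow>\<^sub>E {0<..}) *
        of_real (x powr (real (card I) * (r + 1)) / (r + 1) ^ card I)) \<le>
    real (card I) * 2 ^ card I * (\<Sum>\<^sub>\<infinity>d\<in>I \<rightarrow>\<^sub>E {0<..}. norm (euler_ext I (local_coeff f r I s) d)) *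
      x powr (real (card I) * (r + 1) + s - 1)"
    (is "norm (?L - ?D * of_real ?M) \<le> ?c * ?S * ?e")
proof -
  define N where "N = I \<rightarrow>\<^sub>E {0 :: nat<..}"
  define T where "T d = (\<Prod>i\<in>I. multiples_sum r x (d i))" for d
  have fin: "finite {m :: nat. 1 \<le> m \<and> real m \<le> x}"
    by (rule finite_subset[of _ "{..nat \<lfloor>x\<rfloor>}"]) (auto simp: le_nat_floor)
  \<comment> \<open>Once some component exceeds \<open>x\<close>, one factor of \<open>T d\<close>
    is an empty sum, so the finite sum is also a sum over all of \<open>N\<close>.\<close>
  have L: "((\<lambda>d. tuple_coeff f r I d * of_real (T d)) has_sum ?L) N"
  proof (rule has_sum_cong_neutral[THEN iffD1])
    show "((\<lambda>d. tuple_coeff f r I d * of_real (T d)) has_sum ?L) (I \<rightarrow>\<^sub>E {m. 1 \<le> m \<and> real m \<le> x})"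
      unfolding sum_Lcm_div_Gcd T_def using fin finite_I by (intro has_sum_finite finite_PiE) auto
    fix d assume d: "d \<in> N - (I \<rightarrow>\<^sub>E {m. 1 \<le> m \<and> real m \<le> x})"
    then obtain i where "i \<in> I" "real (d i) > x"
      by (force simp: N_def PiE_iff not_le)
    then have "T d = 0" unfolding T_def using finite_I multiples_sum_eq_0 by auto
    then show "tuple_coeff f r I d * of_real (T d) = 0" by simp
  qed (auto simp: N_def PiE_iff)
  have "((\<lambda>d. euler_ext I (local_coeff f r I 1) d * of_real ?M) has_sum ?D * of_real ?M) N"
    unfolding N_def using abs_summable_summable[OF abs_summable_tuple_coeff[of 1]]
    by (intro has_sum_cmult_left has_sum_infsum) auto
  then have D: "((\<lambda>d. tuple_coeff f r I d * of_real (\<Prod>i\<in>I. x powr (r + 1) / ((r + 1) * real (d i))))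
      has_sum ?D * of_real ?M) N"
  proof (rule has_sum_cong[THEN iffD1, rotated])
    fix d assume d: "d \<in> N"
    have "(\<Prod>i\<in>I. x powr (r + 1) / ((r + 1) * real (d i))) =
        (\<Prod>i\<in>I. real (d i) powr (-1)) * (\<Prod>i\<in>I. x powr (r + 1) / (r + 1))"
      unfolding prod.distrib[symmetric]
      by (rule prod.cong) (use d in \<open>auto simp: N_def PiE_iff powr_minus field_simps\<close>)
    also have "(\<Prod>i\<in>I. x powr (r + 1) / (r + 1)) = ?M"
      using assms(1) by (simp add: power_divide powr_powr mult.commute flip: powr_realpow)
    finally show "euler_ext I (local_coeff f r I 1) d * of_real ?M =
        tuple_coeff f r I d * of_real (\<Prod>i\<in>I. x powr (r + 1) / ((r + 1) * real (d i)))"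
      using d by (simp add: N_def euler_ext_local_coeff)
  qed
  have diff: "((\<lambda>d. tuple_coeff f r I d * of_real (T d) - tuple_coeff f r I d *
      of_real (\<Prod>i\<in>I. x powr (r + 1) / ((r + 1) * real (d i)))) has_sum ?L - ?D * of_real ?M) N"
    using has_sum_add[OF L has_sum_uminusI[OF D]] by simp
  have "((\<lambda>d. norm (euler_ext I (local_coeff f r I s) d) * (?c * ?e)) has_sum ?S * (?c * ?e)) N"
    unfolding N_def using abs_summable_tuple_coeff[of s] assms
    by (intro has_sum_cmult_left has_sum_infsum) auto
  then have "norm (?L - ?D * of_real ?M) \<le> ?S * (?c * ?e)"
  proof (rule norm_infsum_le[OF diff])
    fix d assume d: "d \<in> N"
    have dpos: "d i > 0" if "i \<in> I" for i using d that by (auto simp: N_def PiE_iff)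
    define w where "w = (\<Prod>i\<in>I. real (d i) powr (-s))"
    have "w \<ge> 0" by (auto simp: w_def intro!: prod_nonneg)
    define M where "M = (\<Prod>i\<in>I. x powr (r + 1) / ((r + 1) * real (d i)))"
    have "norm (tuple_coeff f r I d * of_real (T d) - tuple_coeff f r I d * of_real M) =
        norm (tuple_coeff f r I d) * \<bar>T d - M\<bar>"
      by (simp add: norm_mult flip: right_diff_distrib of_real_diff)
    also have "\<dots> \<le> norm (tuple_coeff f r I d) * (?c * ?e * w)"
      unfolding T_def M_def w_def using assms r_nonneg dpos
      by (intro mult_left_mono prod_multiples_sum_error) auto
    also have "\<dots> = norm (euler_ext I (local_coeff f r I s) d) * (?c * ?e)"
      using d \<open>w \<ge> 0\<close> unfolding N_def
      by (simp only: euler_ext_local_coeff norm_mult norm_of_real w_def[symmetric] abs_of_nonneg mult_ac)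
    finally show "norm (tuple_coeff f r I d * of_real (T d) - tuple_coeff f r I d *
        of_real (\<Prod>i\<in>I. x powr (r + 1) / ((r + 1) * real (d i)))) \<le>
        norm (euler_ext I (local_coeff f r I s) d) * (?c * ?e)"
      by (simp add: M_def)
  qed
  then show ?thesis by (simp add: mult_ac)
qed

end

section \<open>Transfer to the class and conclusion\<close>

lemma class_A_function_of_class_A:
  assumes "f \<in> class_A r" "r \<ge> 0" "finite I" "card I \<ge> 2"
  obtains C where "class_A_function f r C I"
proof -
  obtain C1 C2 where mult: "multiplicative_function f"
    and C1: "\<And>p. prime p \<Longrightarrow> norm (f p - of_real (real p powr r)) \<le> C1 * real p powr (r - 1/2)"
    and C2: "\<And>p \<nu>. prime p \<Longrightarrow> \<nu> \<ge> 2 \<Longrightarrow> norm (f (p ^ \<nu>)) \<le> C2 * real p powr (real \<nu> * r)"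
    using assms(1) unfolding class_A_def by blast
  \<comment> \<open>Absolute values, since no signs are given for the two constants; the summand 1
    covers \<open>f 1\<close> and the term \<open>p powr r\<close> in the bound for
    \<open>f p\<close>.\<close>
  define C where "C = 1 + \<bar>C1\<bar> + \<bar>C2\<bar>"
  show thesis
  proof (rule that[of C], unfold_locales)
    fix p :: nat assume p: "prime p"
    then have p1: "real p \<ge> 1" using prime_ge_1_nat by simp
    have "norm (f p - of_real (real p powr r)) \<le> C1 * real p powr (r - 1/2)" by (rule C1[OF p])
    also have "\<dots> \<le> C * real p powr (r - 1/2)" by (intro mult_right_mono) (auto simp: C_def)
    finally show "norm (f p - of_real (real p powr r)) \<le> C * real p powr (r - 1/2)" .
    fix m :: nat
    consider "m = 0" | "m = 1" | "m \<ge> 2" by linarith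
    then show "norm (f (p ^ m)) \<le> C * real p powr (r * real m)"
    proof cases
      case 1
      then show ?thesis using mult p1 by (simp add: multiplicative_function_def C_def)
    next
      case 2
      have "norm (f p) \<le> norm (of_real (real p powr r) :: complex) + norm (f p - of_real (real p powr r))"
        by (rule norm_triangle_sub)
      also have "\<dots> \<le> real p powr r + C1 * real p powr (r - 1/2)" using C1[OF p] by simp
      also have "C1 * real p powr (r - 1/2) \<le> \<bar>C1\<bar> * real p powr r"
        using p1 by (intro mult_mono powr_mono) auto
      also have "real p powr r + \<bar>C1\<bar> * real p powr r = (1 + \<bar>C1\<bar>) * real p powr r"
        by (simp add: distrib_right)
      also have "\<dots> \<le> C * real p powr r" by (intro mult_right_mono) (auto simp: C_def)
      finally show ?thesis using 2 by simp
    next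
      case 3
      have "norm (f (p ^ m)) \<le> C2 * real p powr (real m * r)" by (rule C2[OF p 3])
      also have "\<dots> \<le> C * real p powr (real m * r)" by (intro mult_right_mono) (auto simp: C_def)
      finally show ?thesis by (simp add: mult.commute)
    qed
  qed (use assms mult in \<open>auto simp: C_def\<close>)
qed

text \<open>The exponent \<open>r + 1\<close> splits into the normalisation by \<open>r\<close> and
  the weight \<open>1/p\<close> per unit of exponent.\<close>

lemma local_term_eq:
  assumes "prime p"
  shows "local_term f r k p \<nu> = normalized_local f r {1..k} p \<nu> * of_real (1 / real p) ^ sum \<nu> {1..k}"
proof -
  have p: "real p > 0" using prime_gt_0_nat[OF assms] by simp
  have "real p powr ((r + 1) * real (sum \<nu> {1..k})) =
      real p powr (r * real (sum \<nu> {1..k})) * real p ^ sum \<nu> {1..k}"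
    using p by (simp only: distrib_right mult_1_left powr_add powr_realpow)
  then show ?thesis
    by (simp add: local_term_def normalized_local_def power_one_over power_divide)
qed

theorem theorem2p2:
  fixes k :: nat and r :: real and f :: "nat \<Rightarrow> complex"
  assumes "k \<ge> 2" and "r \<ge> 0" and "f \<in> class_A r"
  shows "(\<forall>p. prime p \<longrightarrow> local_term f r k p summable_on exponent_tuples k) \<and>
         convergent_prod (euler_factor f r k) \<and>
         (\<forall>\<epsilon>::real. \<epsilon> > 0 \<longrightarrow>
            (\<lambda>x::real. lcm_gcd_sum f k x
                 - D_const f r k * of_real (x powr (real k * (r + 1)) / (r + 1) ^ k))
            \<in> O[at_top](\<lambda>x. of_real (x powr (real k * (r + 1) - 1/2 + \<epsilon>))))"
proof -
  define I where "I = {1..k}"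
  have [simp]: "card I = k" by (simp add: I_def)
  obtain C where "class_A_function f r C I"
    using class_A_function_of_class_A[of f r I] assms by (auto simp: I_def)
  then interpret class_A_function f r C I .
  have summable: "local_term f r k p summable_on exponent_tuples k" if "prime p" for p
    using local_summable[OF that] unfolding exponent_tuples_def I_def[symmetric]
    by (rule summable_on_cong[THEN iffD1, rotated]) (simp add: local_term_eq that I_def)
  have factor: "euler_factor f r k =
      (\<lambda>p. if prime p then infsum (local_coeff f r I 1 p) (I \<rightarrow>\<^sub>E UNIV) else 1)"
  proof
    fix p
    have "(\<Sum>\<^sub>\<infinity>\<nu>\<in>exponent_tuples k. local_term f r k p \<nu>) = (\<Sum>\<^sub>\<infinity>\<nu>\<in>I \<rightarrow>\<^sub>E UNIV.
        normalized_local f r I p \<nu> * of_real (1 / real p) ^ sum \<nu> I)" if "prime p"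
      unfolding exponent_tuples_def I_def using that by (intro infsum_cong local_term_eq)
    then show "euler_factor f r k p = (if prime p then infsum (local_coeff f r I 1 p) (I \<rightarrow>\<^sub>E UNIV) else 1)"
      by (simp only: euler_factor_def infsum_local_coeff_1 \<open>card I = k\<close> cong: if_cong)
  qed
  have conv: "convergent_prod (euler_factor f r k)"
  proof (rule abs_convergent_prod_imp_convergent_prod, rule summable_imp_abs_convergent_prod)
    show "summable (\<lambda>p. norm (euler_factor f r k p - 1))"
    proof (rule summable_comparison_test')
      show "summable (\<lambda>p. tail_const 1 * real p powr (-1/2 - 1))"
        by (intro summable_mult) (simp add: summable_real_powr_iff)
      show "norm (norm (euler_factor f r k p - 1)) \<le> tail_const 1 * real p powr (-1/2 - 1)" for p
        using norm_infsum_local_coeff_minus_1_le[of p 1] tail_const_nonneg[of 1]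
        by (auto simp: factor)
    qed
  qed
  \<comment> \<open>The same partial products tend to the infinite product and to the sum over all
    tuples.\<close>
  have D: "D_const f r k = infsum (euler_ext I (local_coeff f r I 1)) (I \<rightarrow>\<^sub>E {0<..})"
  proof (rule LIMSEQ_unique)
    show "(\<lambda>n. \<Prod>p\<le>n. euler_factor f r k p) \<longlonglongrightarrow> D_const f r k"
      unfolding D_const_def by (rule convergent_prod_LIMSEQ[OF conv])
    show "(\<lambda>n. \<Prod>p\<le>n. euler_factor f r k p) \<longlonglongrightarrow>
        infsum (euler_ext I (local_coeff f r I 1)) (I \<rightarrow>\<^sub>E {0<..})"
      unfolding factor
      by (intro euler_product_tendsto finite_I local_coeff_0 abs_summable_local_coeff
          abs_summable_tuple_coeff) auto
  qed
  have "(\<lambda>x::real. lcm_gcd_sum f k x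
          - D_const f r k * of_real (x powr (real k * (r + 1)) / (r + 1) ^ k))
        \<in> O[at_top](\<lambda>x. of_real (x powr (real k * (r + 1) - 1/2 + \<epsilon>)))" if "\<epsilon> > 0" for \<epsilon> :: real
  proof -
    \<comment> \<open>The cap keeps \<open>s\<close> at most 1, as the error lemma requires; for
      large \<open>\<epsilon>\<close> the stronger bound at \<open>s = 1\<close> is weakened by
      monotonicity, as \<open>x\<close> is at least 1.\<close>
    define s where "s = 1/2 + min \<epsilon> (1/2)"
    define S where "S = (\<Sum>\<^sub>\<infinity>d\<in>I \<rightarrow>\<^sub>E {0<..}. norm (euler_ext I (local_coeff f r I s) d))"
    have s: "1/2 < s" "s \<le> 1" using that by (auto simp: s_def)
    have "S \<ge> 0" unfolding S_def by (intro infsum_nonneg) auto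
    show ?thesis
    proof (rule bigoI[where c = "real k * 2 ^ k * S"], rule eventually_mono[OF eventually_ge_at_top[of 1]])
      fix x :: real assume x: "x \<ge> 1"
      have "norm (lcm_gcd_sum f k x - D_const f r k * of_real (x powr (real k * (r + 1)) / (r + 1) ^ k)) \<le>
          real k * 2 ^ k * S * x powr (real k * (r + 1) + s - 1)"
        using sum_Lcm_div_Gcd_asymptotics[OF x s]
        unfolding D lcm_gcd_sum_def S_def I_def[symmetric] \<open>card I = k\<close> .
      also have "\<dots> \<le> real k * 2 ^ k * S * x powr (real k * (r + 1) - 1/2 + \<epsilon>)"
        using x \<open>S \<ge> 0\<close> by (intro mult_left_mono powr_mono) (auto simp: s_def)
      finally show "norm (lcm_gcd_sum f k x - D_const f r k * of_real (x powr (real k * (r + 1)) / (r + 1) ^ k))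
          \<le> real k * 2 ^ k * S * norm (of_real (x powr (real k * (r + 1) - 1/2 + \<epsilon>)) :: complex)"
        by simp
    qed
  qed
  with summable conv show ?thesis by blast
qed

end
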